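(* Let $X$ be a Hilbert $C^*$-module over a $C^*$-algebra $\mathsf{A}$ and let $(x_n)_n$ be a frame or an outer frame for $X$ with analysis operator $U$. An operator $V\in\mathbb{B}(X,\ell^2(\mathsf{A}))$ is the analysis operator of a frame or an outer frame dual to $(x_n)_n$ if and only if $V$ is of the form $$V=U(U^*U)^{-1}+\left(I-U(U^*U)^{-1}U^*\right)L$$ for some $L\in\mathbb{B}(X,\ell^2(\mathsf{A}))$.
   Context: $\mathsf{A}$ is an arbitrary $C^*$-algebra (not necessarily unital) with multiplier algebra $M(\mathsf{A})$. Hilbert $\mathsf{A}$-modules are right modules with inner product $\mathsf{A}$-linear in the second variable; they are not assumed full. $\mathbb{B}(X,Y)$ denotes the adjointable operators from $X$ to $Y$; $I$ is the identity operator. $\ell^2(\mathsf{A})$ is the Hilbert $\mathsf{A}$-module of sequences $(a_n)_n$ in $\mathsf{A}$ with $\sum_n a_n^*a_n$ norm convergent, with inner product $\langle (a_n)_n,(b_n)_n\rangle=\sum_n a_n^*b_n$. $M(X)$ denotes the multiplier module of $X$: $M(X)=\mathbb{B}(\mathsf{A},X)$, a Hilbert $M(\mathsf{A})$-module with $\langle v,w\rangle=v^*w\in\mathbb{B}(\mathsf{A})=M(\mathsf{A})$, containing $X$ via $x\mapsto(a\mapsto xa)$, and $M(X)\mathsf{A}=X$; thus $\langle v,x\rangle\in\mathsf{A}$ for $v\in M(X)$, $x\in X$. All sequences are infinite, indexed by $\mathbb{N}$. A sequence $(x_n)_n$ in $X$ is a frame for $X$ if there are constants $A,B>0$ with $A\langle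 x,x\rangle\le\sum_{n=1}^\infty\langle x,x_n\rangle\langle x_n,x\rangle\le B\langle x,x\rangle$ for all $x\in X$, the series converging in norm. A sequence $(x_n)_n$ in $M(X)$ is an outer frame for $X$ if $x_n\in M(X)\setminus X$ for at least one $n$ and the same inequalities hold for all $x\in X$ (with norm convergence in $\mathsf{A}$) for some $A,B>0$. The analysis operator of a frame or outer frame $(x_n)_n$ is $U\in\mathbb{B}(X,\ell^2(\mathsf{A}))$, $Ux=(\langle x_n,x\rangle)_n$; its adjoint is $U^*((a_n)_n)=\sum_{n=1}^\infty x_na_n$; $U^*U$ is invertible in $\mathbb{B}(X)$. A frame or outer frame $(y_n)_n$ for $X$ is dual to $(x_n)_n$ if $\sum_{n=1}^\infty y_n\langle x_n,x\rangle=x$ for all $x\in X$ (norm convergence). *)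

theory Defs
  imports "HOL-Analysis.Analysis" "HOL-Library.Function_Algebras"
begin

class complex_banach = banach +
  fixes scaleC :: "complex \<Rightarrow> 'a \<Rightarrow> 'a" (infixr "*\<^sub>C" 75)
  assumes scaleC_add_right: "c *\<^sub>C (x + y) = c *\<^sub>C x + c *\<^sub>C y"
    and scaleC_add_left: "(c + d) *\<^sub>C x = c *\<^sub>C x + d *\<^sub>C x"
    and scaleC_scaleC: "c *\<^sub>C (d *\<^sub>C x) = (c * d) *\<^sub>C x"
    and scaleC_of_real: "complex_of_real r *\<^sub>C x = r *\<^sub>R x"
    and norm_scaleC: "norm (c *\<^sub>C x) = cmod c * norm x"

text \<open>The class \<^class>\<open>real_normed_algebra\<close> is that of possibly non-unital normed algebras, so no
  unit is assumed here, and the zero algebra is allowed.\<close>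

class cstar_algebra = complex_banach + real_normed_algebra +
  fixes star :: "'a \<Rightarrow> 'a"
  assumes mult_scaleC_left: "(c *\<^sub>C a) * b = c *\<^sub>C (a * b)"
    and mult_scaleC_right: "a * (c *\<^sub>C b) = c *\<^sub>C (a * b)"
    and star_star: "star (star a) = a"
    and star_add: "star (a + b) = star a + star b"
    and star_scaleC: "star (c *\<^sub>C a) = cnj c *\<^sub>C star a"
    and star_mult: "star (a * b) = star b * star a"
    and norm_star_mult: "norm (star a * a) = (norm a)\<^sup>2"

definition cpos :: "'a::cstar_algebra \<Rightarrow> bool"
  where "cpos a \<longleftrightarrow> (\<exists>b. a = star b * b)"

definition cle :: "'a::cstar_algebra \<Rightarrow> 'a \<Rightarrow> bool"  (infix "\<preceq>" 50)
  where "a \<preceq> b \<longleftrightarrow> cpos (b - a)"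

text \<open>A right Hilbert module is a Banach space type whose norm is the one induced by the
  algebra-valued inner product; completeness is part of the class. No fullness is assumed.\<close>

locale hilbert_module =
  fixes act :: "'x::complex_banach \<Rightarrow> 'a::cstar_algebra \<Rightarrow> 'x"
    and ip :: "'x \<Rightarrow> 'x \<Rightarrow> 'a"
  assumes act_add_left: "act (x + y) a = act x a + act y a"
    and act_add_right: "act x (a + b) = act x a + act x b"
    and act_mult: "act x (a * b) = act (act x a) b"
    and act_scaleC_left: "act (c *\<^sub>C x) a = c *\<^sub>C act x a"
    and act_scaleC_right: "act x (c *\<^sub>C a) = c *\<^sub>C act x a"
    and ip_add_right: "ip x (y + z) = ip x y + ip x z"
    and ip_scaleC_right: "ip x (c *\<^sub>C y) = c *\<^sub>C ip x y"
    and ip_act_right: "ip x (act y a) = ip x y * a"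
    and ip_star: "star (ip x y) = ip y x"
    and ip_pos: "cpos (ip x x)"
    and ip_definite: "ip x x = 0 \<Longrightarrow> x = 0"
    and norm_ip: "norm x = sqrt (norm (ip x x))"

text \<open>Adjointable operators from a module with inner product \<open>ip1\<close>, given by a whole type, to a
  module with carrier \<open>T\<close> and inner product \<open>ip2\<close>. As usual, linearity and boundedness
  are consequences of adjointability. The adjoint is only meaningful on \<open>T\<close>.\<close>

definition adjointable ::
  "('x \<Rightarrow> 'x \<Rightarrow> 'a) \<Rightarrow> 'y set \<Rightarrow> ('y \<Rightarrow> 'y \<Rightarrow> 'a) \<Rightarrow> ('x \<Rightarrow> 'y) set"
  where "adjointable ip1 T ip2 =
    {f. (\<forall>x. f x \<in> T) \<and> (\<exists>g. \<forall>x. \<forall>y\<in>T. ip2 (f x) y = ip1 x (g y))}"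

definition adjoint_op ::
  "('x \<Rightarrow> 'x \<Rightarrow> 'a) \<Rightarrow> ('y \<Rightarrow> 'y \<Rightarrow> 'a) \<Rightarrow> ('x \<Rightarrow> 'y) \<Rightarrow> 'y \<Rightarrow> 'x"
  where "adjoint_op ip1 ip2 f y = (THE z. \<forall>x. ip2 (f x) y = ip1 x z)"

definition alg_ip :: "'a::cstar_algebra \<Rightarrow> 'a \<Rightarrow> 'a"
  where "alg_ip a b = star a * b"

definition ell2 :: "(nat \<Rightarrow> 'a::cstar_algebra) set"
  where "ell2 = {a. summable (\<lambda>n. star (a n) * a n)}"

definition ell2_ip :: "(nat \<Rightarrow> 'a::cstar_algebra) \<Rightarrow> (nat \<Rightarrow> 'a) \<Rightarrow> 'a"
  where "ell2_ip a b = (\<Sum>n. star (a n) * b n)"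

text \<open>The multiplier module of \<open>X\<close> consists of the adjointable operators from the algebra to \<open>X\<close>.
  The canonical embedding of \<open>X\<close> sends \<open>x\<close> to \<open>act x\<close>, so that \<open>range act\<close> is the copy
  of \<open>X\<close> in it.\<close>

definition multiplier_module :: "('x \<Rightarrow> 'x \<Rightarrow> 'a::cstar_algebra) \<Rightarrow> ('a \<Rightarrow> 'x) set"
  where "multiplier_module ip = adjointable alg_ip UNIV ip"

definition mult_ip :: "('x \<Rightarrow> 'x \<Rightarrow> 'a::cstar_algebra) \<Rightarrow> ('a \<Rightarrow> 'x) \<Rightarrow> ('a \<Rightarrow> 'x) \<Rightarrow> 'a \<Rightarrow> 'a"
  where "mult_ip ip v w = adjoint_op alg_ip ip v \<circ> w"

text \<open>For \<open>v\<close> in the multiplier module and \<open>x\<close> in \<open>X\<close>, the multiplier \<open>\<langle>v, x\<rangle>\<close> lies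
  in the algebra; \<open>mod_ip ip v x\<close> is that element. See \<open>mult_ip_act_right\<close>
  and \<open>mult_ip_act_left\<close> below.\<close>

definition mod_ip :: "('x \<Rightarrow> 'x \<Rightarrow> 'a::cstar_algebra) \<Rightarrow> ('a \<Rightarrow> 'x) \<Rightarrow> 'x \<Rightarrow> 'a"
  where "mod_ip ip v x = adjoint_op alg_ip ip v x"

definition is_frame :: "('x \<Rightarrow> 'x \<Rightarrow> 'a::cstar_algebra) \<Rightarrow> (nat \<Rightarrow> 'x) \<Rightarrow> bool"
  where "is_frame ip z \<longleftrightarrow>
    (\<exists>A>0. \<exists>B>0. \<forall>x.
      summable (\<lambda>n. ip x (z n) * ip (z n) x) \<and>
      A *\<^sub>R ip x x \<preceq> (\<Sum>n. ip x (z n) * ip (z n) x) \<and>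
      (\<Sum>n. ip x (z n) * ip (z n) x) \<preceq> B *\<^sub>R ip x x)"

definition is_outer_frame ::
  "('x \<Rightarrow> 'a \<Rightarrow> 'x) \<Rightarrow> ('x \<Rightarrow> 'x \<Rightarrow> 'a::cstar_algebra) \<Rightarrow> (nat \<Rightarrow> 'a \<Rightarrow> 'x) \<Rightarrow> bool"
  where "is_outer_frame act ip v \<longleftrightarrow>
    (\<forall>n. v n \<in> multiplier_module ip) \<and> (\<exists>n. v n \<notin> range act) \<and>
    (\<exists>A>0. \<exists>B>0. \<forall>x.
      summable (\<lambda>n. star (mod_ip ip (v n) x) * mod_ip ip (v n) x) \<and>
      A *\<^sub>R ip x x \<preceq> (\<Sum>n. star (mod_ip ip (v n) x) * mod_ip ip (v n) x) \<and>
      (\<Sum>n. star (mod_ip ip (v n) x) * mod_ip ip (v n) x) \<preceq> B *\<^sub>R ip x x)"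

text \<open>Sequences in \<open>X\<close> are regarded as sequences in the multiplier module via the embedding.\<close>

definition frame_or_outer_frame ::
  "('x \<Rightarrow> 'a \<Rightarrow> 'x) \<Rightarrow> ('x \<Rightarrow> 'x \<Rightarrow> 'a::cstar_algebra) \<Rightarrow> (nat \<Rightarrow> 'a \<Rightarrow> 'x) \<Rightarrow> bool"
  where "frame_or_outer_frame act ip v \<longleftrightarrow>
    (\<exists>z. is_frame ip z \<and> v = (\<lambda>n. act (z n))) \<or> is_outer_frame act ip v"

definition analysis_op ::
  "('x \<Rightarrow> 'x \<Rightarrow> 'a::cstar_algebra) \<Rightarrow> (nat \<Rightarrow> 'a \<Rightarrow> 'x) \<Rightarrow> 'x \<Rightarrow> nat \<Rightarrow> 'a"
  where "analysis_op ip v x = (\<lambda>n. mod_ip ip (v n) x)"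

definition is_dual_to ::
  "('x::real_normed_vector \<Rightarrow> 'x \<Rightarrow> 'a::cstar_algebra) \<Rightarrow> (nat \<Rightarrow> 'a \<Rightarrow> 'x) \<Rightarrow> (nat \<Rightarrow> 'a \<Rightarrow> 'x) \<Rightarrow> bool"
  where "is_dual_to ip w v \<longleftrightarrow> (\<forall>x. (\<lambda>n. w n (mod_ip ip (v n) x)) sums x)"

lemma alg_ip_eq_imp_eq:
  assumes "\<And>a. alg_ip a b = alg_ip a (c :: 'a::cstar_algebra)"
  shows "b = c"
proof -
  have "star (b - c) * (b - c) = 0"
    using assms[of "b - c"] by (simp add: alg_ip_def right_diff_distrib)
  then show ?thesis using norm_star_mult[of "b - c"] by simp
qed

lemma mod_ip_eqI:
  assumes "\<And>a. ip (v a) x = star a * b"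
  shows "mod_ip ip v x = b"
  unfolding mod_ip_def adjoint_op_def
proof (rule the_equality)
  show "\<forall>a. ip (v a) x = alg_ip a b" using assms by (simp add: alg_ip_def)
next
  fix z assume "\<forall>a. ip (v a) x = alg_ip a z"
  then have "alg_ip a z = alg_ip a b" for a using assms by (simp add: alg_ip_def)
  then show "z = b" by (rule alg_ip_eq_imp_eq)
qed

lemma ip_multiplier:
  assumes "v \<in> multiplier_module ip"
  shows "ip (v a) x = star a * mod_ip ip v x"
proof -
  obtain g where g: "\<And>a x. ip (v a) x = alg_ip a (g x)"
    using assms by (auto simp: multiplier_module_def adjointable_def)
  have "mod_ip ip v x = g x" by (rule mod_ip_eqI) (simp add: g alg_ip_def)
  then show ?thesis by (simp add: g alg_ip_def)
qed

context hilbert_module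
begin

lemma ip_act_left: "ip (act x a) y = star a * ip x y"
  by (metis ip_act_right ip_star star_mult)

lemma act_in_multiplier_module: "act x \<in> multiplier_module ip"
  unfolding multiplier_module_def adjointable_def alg_ip_def using ip_act_left by auto

lemma mod_ip_act: "mod_ip ip (act x) y = ip x y"
  by (rule mod_ip_eqI) (rule ip_act_left)

lemma mult_ip_act_right:
  assumes "v \<in> multiplier_module ip"
  shows "mult_ip ip v (act x) = (\<lambda>a. mod_ip ip v x * a)"
proof
  fix a
  have "mod_ip ip v (act x a) = mod_ip ip v x * a"
    by (rule mod_ip_eqI) (simp add: ip_act_right ip_multiplier[OF assms] mult.assoc)
  then show "mult_ip ip v (act x) a = mod_ip ip v x * a"
    by (simp add: mult_ip_def mod_ip_def)
qed

lemma mult_ip_act_left: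
  assumes "v \<in> multiplier_module ip"
  shows "mult_ip ip (act x) v = (\<lambda>a. star (mod_ip ip v x) * a)"
proof
  fix a
  have "mult_ip ip (act x) v a = ip x (v a)"
    using mod_ip_act by (simp add: mult_ip_def mod_ip_def)
  also have "\<dots> = star (mod_ip ip v x) * a"
    by (metis ip_multiplier[OF assms] ip_star star_mult star_star)
  finally show "mult_ip ip (act x) v a = star (mod_ip ip v x) * a" .
qed

end

end

theory Submission
  imports Defs
begin

text \<open>The adjoint of the analysis operator of \<open>(y\<^sub>n)\<close> is synthesis, so \<open>(y\<^sub>n)\<close> is dual to \<open>(x\<^sub>n)\<close> exactly
  when \<open>U\<^sup>* V = I\<close>. The operators of the stated form satisfy this equation, and each \<open>V\<close> with
  \<open>U\<^sup>* V = I\<close> has it with \<open>L = V\<close>. Conversely, an adjointable \<open>V\<close> is the analysis operator of the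
  multipliers \<open>y\<^sub>n a = V\<^sup>* (a e\<^sub>n)\<close>. They satisfy the lower frame inequality, since for an
  upper bound \<open>B\<close> of \<open>U\<^sup>* U\<close> positivity of \<open>\<langle>(V - U / B) x, (V - U / B) x\<rangle>\<close> yields \<open>V\<^sup>* V \<ge> I / B\<close>.

  In order to get by without spectral theory, a selfadjoint operator \<open>f\<close> is called nonnegative if
  \<open>\<parallel>t - f\<parallel> \<le> t\<close> for some \<open>t \<ge> 0\<close>. Such operators obviously form a convex cone, and they have
  square roots by an iteration that converges in norm.\<close>

section \<open>Square roots of bounded operators by iteration\<close>

lemma blinfun_compose_eq_iff:
  "f o\<^sub>L g = f' o\<^sub>L g' \<longleftrightarrow> (\<forall>x. blinfun_apply f (blinfun_apply g x) = f' (blinfun_apply g' x))"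
  by (metis blinfun_apply_blinfun_compose blinfun_eqI)

text \<open>With \<open>w = id_blinfun - h\<close>, the operator 1 - z squares to \<open>h\<close>
  as soon as z = (w + z^2) / 2. The iteration for this equation is dominated by the scalar iteration
  \<open>e\<close>, which increases and stays at most 1. The last property lets the root inherit
  whatever passes to limits, linear combinations and squares; it will serve for selfadjointness and
  commutation.\<close>

lemma blinfun_sqrt:
  fixes h :: "'x::banach \<Rightarrow>\<^sub>L 'x"
  assumes h: "norm (id_blinfun - h) \<le> 1"
  obtains r :: "'x \<Rightarrow>\<^sub>L 'x" where "\<And>x. r (r x) = h x" "norm (id_blinfun - r) \<le> 1"
    "\<And>P. closed P \<Longrightarrow> subspace P \<Longrightarrow> (\<And>f. f \<in> P \<Longrightarrow> f o\<^sub>L f \<in> P) \<Longrightarrow> id_blinfun \<in> P \<Longrightarrow> h \<in> P \<Longrightarrow> r \<in> P"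
proof -
  define w where "w = id_blinfun - h"
  define y where "y = rec_nat (0 :: 'x \<Rightarrow>\<^sub>L 'x) (\<lambda>_ f. (1/2) *\<^sub>R (w + (f o\<^sub>L f)))"
  define e where "e = rec_nat (0 :: real) (\<lambda>_ t. (1 + t\<^sup>2) / 2)"
  have y0: "y 0 = 0" and yS: "y (Suc n) = (1/2) *\<^sub>R (w + (y n o\<^sub>L y n))" for n
    by (simp_all add: y_def)
  have e0: "e 0 = 0" and eS: "e (Suc n) = (1 + (e n)\<^sup>2) / 2" for n
    by (simp_all add: e_def)
  have e_bounds: "0 \<le> e n \<and> e n \<le> 1" for n
    by (induction n) (auto simp: e0 eS power_le_one)
  have e_mono: "e n \<le> e (Suc n)" for n
    using zero_le_power2[of "1 - e n"] by (simp add: eS power2_eq_square algebra_simps)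
  have y_le: "norm (y n) \<le> e n" for n
  proof (induction n)
    case (Suc n)
    have "norm (y n o\<^sub>L y n) \<le> (e n)\<^sup>2"
      using norm_blinfun_compose[of "y n" "y n"] mult_mono[OF Suc Suc] e_bounds[of n]
      by (simp add: power2_eq_square)
    then have "norm (w + (y n o\<^sub>L y n)) \<le> 1 + (e n)\<^sup>2"
      using norm_triangle_ineq[of w "y n o\<^sub>L y n"] h by (simp add: w_def)
    then show ?case by (simp add: yS eS)
  qed (simp add: y0 e0)
  \<comment> \<open>Each \<open>y n\<close> is a polynomial in \<open>w\<close>, so whatever
    commutes with \<open>w\<close> commutes with it. In particular the iterates commute with each
    other.\<close>
  have comm_w: "c (y n x) = y n (c x)" if "\<And>x. c (w x) = w (c x)" for c :: "'x \<Rightarrow>\<^sub>L 'x" and n x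
    by (induction n arbitrary: x) (simp_all add: y0 yS blinfun.bilinear_simps that)
  have comm: "y m (y n x) = y n (y m x)" for m n x
    by (rule comm_w) (rule comm_w[symmetric], simp)
  have step: "norm (y (Suc n) - y n) \<le> e (Suc n) - e n" for n
  proof (induction n)
    case (Suc n)
    have "y (Suc (Suc n)) - y (Suc n)
        = (1/2) *\<^sub>R (w + (y (Suc n) o\<^sub>L y (Suc n))) - (1/2) *\<^sub>R (w + (y n o\<^sub>L y n))"
      by (rule arg_cong2[where f = minus, OF yS yS])
    \<comment> \<open>The difference of squares factors because the iterates commute.\<close>
    also have "\<dots> = (1/2) *\<^sub>R ((y (Suc n) + y n) o\<^sub>L (y (Suc n) - y n))"
      by (rule blinfun_eqI)
        (simp add: blinfun.bilinear_simps comm[of n "Suc n"] scaleR_diff_right[symmetric] del: scaleR_diff_right)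
    also have "norm \<dots> \<le> (1/2) * ((e (Suc n) + e n) * (e (Suc n) - e n))"
    proof -
      have "norm (y (Suc n) + y n) \<le> e (Suc n) + e n"
        using norm_triangle_ineq[of "y (Suc n)" "y n"] y_le[of n] y_le[of "Suc n"] by linarith
      then have "norm (y (Suc n) + y n) * norm (y (Suc n) - y n) \<le> (e (Suc n) + e n) * (e (Suc n) - e n)"
        using Suc e_bounds[of n] e_bounds[of "Suc n"] by (intro mult_mono) auto
      then show ?thesis
        using norm_blinfun_compose[of "y (Suc n) + y n" "y (Suc n) - y n"] by simp
    qed
    also have "\<dots> = e (Suc (Suc n)) - e (Suc n)"
      using arg_cong2[where f = minus, OF eS[of "Suc n"] eS[of n]] by (simp add: power2_eq_square field_simps)
    finally show ?case .
  qed (use h in \<open>simp add: y0 e0 yS eS w_def\<close>)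
  have "incseq e" using e_mono by (rule incseq_SucI)
  then obtain l where "e \<longlonglongrightarrow> l" using e_bounds incseq_convergent[of e 1] by blast
  \<comment> \<open>The telescoping increments of \<open>e\<close> are a summable majorant for those
    of \<open>y\<close>.\<close>
  then have "summable (\<lambda>n. e (Suc n) - e n)" by (rule telescope_summable)
  then have "summable (\<lambda>n. y (Suc n) - y n)"
    by (rule summable_comparison_test[rotated]) (use step in blast)
  then have "convergent y"
    by (simp add: summable_iff_convergent sum_lessThan_telescope y0)
  then obtain z where z: "y \<longlonglongrightarrow> z" by (auto simp: convergent_def)
  have "(\<lambda>n. (1/2) *\<^sub>R (w + (y n o\<^sub>L y n))) \<longlonglongrightarrow> (1/2) *\<^sub>R (w + (z o\<^sub>L z))"
    by (intro tendsto_intros z bounded_bilinear.tendsto[OF bounded_bilinear_blinfun_compose])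
  then have "(\<lambda>n. y (Suc n)) \<longlonglongrightarrow> (1/2) *\<^sub>R (w + (z o\<^sub>L z))" by (simp add: yS)
  then have z_eq: "z = (1/2) *\<^sub>R (w + (z o\<^sub>L z))"
    using z LIMSEQ_Suc LIMSEQ_unique by blast
  define r where "r = id_blinfun - z"
  show thesis
  proof (rule that[of r])
    fix x
    have "z x = (1/2) *\<^sub>R (w x + z (z x))"
      by (subst z_eq) (simp add: blinfun.bilinear_simps)
    then have "2 *\<^sub>R z x = 2 *\<^sub>R ((1/2) *\<^sub>R (w x + z (z x)))" by simp
    then have "2 *\<^sub>R z x = x - h x + z (z x)" by (simp add: w_def blinfun.bilinear_simps)
    then show "r (r x) = h x" by (simp add: r_def blinfun.bilinear_simps algebra_simps scaleR_2)
  next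
    have "norm (y n) \<le> 1" for n using y_le[of n] e_bounds[of n] by linarith
    then show "norm (id_blinfun - r) \<le> 1"
      using LIMSEQ_le_const2[OF tendsto_norm[OF z], of 1] by (auto simp: r_def)
  next
    fix P :: "('x \<Rightarrow>\<^sub>L 'x) set"
    assume P: "closed P" "subspace P" "\<And>f. f \<in> P \<Longrightarrow> f o\<^sub>L f \<in> P" "id_blinfun \<in> P" "h \<in> P"
    then have "w \<in> P" by (simp add: w_def subspace_diff)
    then have "y n \<in> P" for n
      by (induction n) (simp_all add: y0 yS P subspace_0 subspace_add subspace_scale)
    then have "z \<in> P" using closed_sequentially[OF P(1) _ z] by blast
    then show "r \<in> P" using P by (simp add: r_def subspace_diff)
  qed
qed

section \<open>Involution and complex scalars\<close>

lemma star_zero [simp]: "star 0 = (0::'a::cstar_algebra)"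
  by (metis add_cancel_right_left star_add)

lemma star_scaleR: "star (r *\<^sub>R a) = r *\<^sub>R star (a::'a::cstar_algebra)"
  by (metis complex_cnj_complex_of_real scaleC_of_real star_scaleC)

lemma star_minus: "star (- a) = - star (a::'a::cstar_algebra)"
  using star_scaleR[of "-1" a] by simp

lemma star_diff: "star (a - b) = star a - star (b::'a::cstar_algebra)"
  by (metis add_uminus_conv_diff star_add star_minus)

lemma norm_star: "norm (star a) = norm (a::'a::cstar_algebra)"
proof -
  have *: "norm b \<le> norm (star b)" for b :: 'a
  proof (cases "b = 0")
    case False
    have "norm b * norm b \<le> norm (star b) * norm b"
      using norm_star_mult[of b] norm_mult_ineq[of "star b" b] by (simp add: power2_eq_square)
    then show ?thesis using False by simp
  qed simp
  show ?thesis using *[of a] *[of "star a"] by (simp add: star_star)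
qed

lemma bounded_linear_star: "bounded_linear (star :: 'a::cstar_algebra \<Rightarrow> 'a)"
  by (rule bounded_linear_intro[where K=1]) (simp_all add: star_add star_scaleR norm_star)

lemma scaleC_i_i: "\<i> *\<^sub>C \<i> *\<^sub>C x = - (x::'x::complex_banach)"
  using scaleC_of_real[of "-1" x] by (simp add: scaleC_scaleC)

lemma scaleC_one [simp]: "1 *\<^sub>C x = (x::'x::complex_banach)"
  using scaleC_of_real[of 1 x] by simp

lemma scaleC_minus_left: "(- c) *\<^sub>C x = - (c *\<^sub>C x::'x::complex_banach)"
  using scaleC_scaleC[of "-1" c x] scaleC_of_real[of "-1" "c *\<^sub>C x"] by simp

lemma scaleC_scaleR: "c *\<^sub>C r *\<^sub>R x = r *\<^sub>R c *\<^sub>C (x::'x::complex_banach)"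
  by (metis mult.commute scaleC_of_real scaleC_scaleC)

lemma bounded_linear_scaleC: "bounded_linear (\<lambda>x::'x::complex_banach. c *\<^sub>C x)"
  by (rule bounded_linear_intro[where K="cmod c"])
    (simp_all add: scaleC_add_right scaleC_scaleR norm_scaleC)

lemmas scaleC_diff_right = linear_diff[OF bounded_linear.linear[OF bounded_linear_scaleC]]

section \<open>The inner product as a bounded bilinear map\<close>

context hilbert_module
begin

lemma ip_add_left: "ip (x + y) z = ip x z + ip y z"
  by (metis ip_add_right ip_star star_add)

lemma ip_scaleC_left: "ip (c *\<^sub>C x) y = cnj c *\<^sub>C ip x y"
  by (metis ip_scaleC_right ip_star star_scaleC)

lemma ip_scaleR_right: "ip x (r *\<^sub>R y) = r *\<^sub>R ip x y"
  by (metis ip_scaleC_right scaleC_of_real)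

lemma ip_scaleR_left: "ip (r *\<^sub>R x) y = r *\<^sub>R ip x y"
  by (metis ip_scaleR_right ip_star star_scaleR)

lemma norm_ip_self: "norm (ip x x) = (norm x)\<^sup>2"
  by (simp add: norm_ip)

lemma polarization:
  "4 *\<^sub>R ip x y = ip (x + y) (x + y) - ip (x - y) (x - y)
    - \<i> *\<^sub>C ip (x + \<i> *\<^sub>C y) (x + \<i> *\<^sub>C y) + \<i> *\<^sub>C ip (x - \<i> *\<^sub>C y) (x - \<i> *\<^sub>C y)"
proof -
  have e: "ip (x + c *\<^sub>C y) (x + c *\<^sub>C y)
      = ip x x + c *\<^sub>C ip x y + cnj c *\<^sub>C ip y x + (cnj c * c) *\<^sub>C ip y y" for c
    by (simp add: ip_add_left ip_add_right ip_scaleC_left ip_scaleC_right scaleC_add_right scaleC_scaleC mult.commute)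
  have e1: "ip (x + y) (x + y) = ip x x + ip x y + ip y x + ip y y"
    using e[of 1] by simp
  have e2: "ip (x - y) (x - y) = ip x x - ip x y - ip y x + ip y y"
    using e[of "-1"] by (simp add: scaleC_minus_left)
  have e3: "ip (x + \<i> *\<^sub>C y) (x + \<i> *\<^sub>C y)
      = ip x x + \<i> *\<^sub>C ip x y - \<i> *\<^sub>C ip y x + ip y y"
    using e[of \<i>] by (simp add: scaleC_minus_left)
  have e4: "ip (x - \<i> *\<^sub>C y) (x - \<i> *\<^sub>C y)
      = ip x x - \<i> *\<^sub>C ip x y + \<i> *\<^sub>C ip y x + ip y y"
    using e[of "-\<i>"] by (simp add: scaleC_minus_left)
  have 4: "4 *\<^sub>R u = u + u + (u + u)" for u :: 'a
    by (metis (no_types, opaque_lifting) numeral_Bit0 scaleR_2 scaleR_left_distrib)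
  show ?thesis
    unfolding e1 e2 e3 e4 4
    by (simp add: scaleC_add_right scaleC_diff_right scaleC_i_i algebra_simps)
qed

text \<open>At unit vectors, polarization leaves four terms of norm at most (1 + 1)^2 = 4, divided
  by 4. The triangle inequality of the given norm thus replaces the order argument of the
  Cauchy-Schwarz inequality, at the cost of the factor 4.\<close>

lemma norm_ip_le: "norm (ip x y) \<le> 4 * (norm x * norm y)"
proof -
  have *: "norm (ip u v) \<le> (norm u + norm v)\<^sup>2" for u v
  proof -
    have q: "norm (ip (u + c *\<^sub>C v) (u + c *\<^sub>C v)) \<le> (norm u + norm v)\<^sup>2" if "cmod c = 1" for c
      using norm_triangle_ineq[of u "c *\<^sub>C v"] that by (simp add: norm_ip_self norm_scaleC power_mono)
    have i: "norm (\<i> *\<^sub>C a) = norm a" for a :: 'a by (simp add: norm_scaleC)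
    have "norm (4 *\<^sub>R ip u v) \<le> norm (ip (u + v) (u + v)) + norm (ip (u - v) (u - v))
      + norm (\<i> *\<^sub>C ip (u + \<i> *\<^sub>C v) (u + \<i> *\<^sub>C v)) + norm (\<i> *\<^sub>C ip (u - \<i> *\<^sub>C v) (u - \<i> *\<^sub>C v))"
      unfolding polarization
      by (intro order_trans[OF norm_triangle_ineq] add_mono order_trans[OF norm_triangle_ineq4] order_refl)
    also have "\<dots> \<le> 4 * (norm u + norm v)\<^sup>2"
      unfolding i using q[of 1] q[of "-1"] q[of \<i>] q[of "-\<i>"] by (simp add: scaleC_minus_left)
    finally show ?thesis by simp
  qed
  show ?thesis
  proof (cases "x = 0 \<or> y = 0")
    case True
    then show ?thesis using ip_scaleR_left[of 0 x y] ip_scaleR_right[of x 0 y] by auto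
  next
    case False
    then have n: "norm x > 0" "norm y > 0" by auto
    have "ip x y = (norm x * norm y) *\<^sub>R ip ((1 / norm x) *\<^sub>R x) ((1 / norm y) *\<^sub>R y)"
      using n by (simp add: ip_scaleR_left ip_scaleR_right)
    also have "norm \<dots> \<le> (norm x * norm y) * 4"
      using *[of "(1 / norm x) *\<^sub>R x" "(1 / norm y) *\<^sub>R y"] n 
      unfolding norm_scaleR abs_mult abs_norm_cancel by (intro mult_left_mono) auto
    finally show ?thesis by simp
  qed
qed

lemma bounded_bilinear_ip: "bounded_bilinear ip"
  by unfold_locales
    (use norm_ip_le in \<open>auto simp: ip_add_left ip_add_right ip_scaleR_left ip_scaleR_right mult_ac intro!: exI[of _ 4]\<close>)

sublocale ip: bounded_bilinear ip by (rule bounded_bilinear_ip)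

lemma ip_eqI:
  assumes "\<And>z. ip z x = ip z y"
  shows "x = y"
  using ip_definite[of "x - y"] assms[of "x - y"] by (simp add: ip.diff_right)

lemma ip_eq_iff: "x = y \<longleftrightarrow> (\<forall>z. ip z x = ip z y)"
  using ip_eqI by auto

text \<open>The type of bounded operators only records real linearity; complex linearity comes from
  having an adjoint.\<close>

lemma adjoint_scaleC:
  assumes "\<And>x y. ip (f x) y = ip x (g y)"
  shows "f (c *\<^sub>C x) = c *\<^sub>C f x" "g (c *\<^sub>C x) = c *\<^sub>C g x"
proof -
  have *: "ip z (f x) = ip (g z) x" for x z by (metis assms ip_star)
  show "f (c *\<^sub>C x) = c *\<^sub>C f x" by (rule ip_eqI) (simp add: * ip_scaleC_right)
  show "g (c *\<^sub>C x) = c *\<^sub>C g x" by (rule ip_eqI) (simp add: assms[symmetric] ip_scaleC_right)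
qed

subsection \<open>Selfadjoint and nonnegative operators\<close>

definition selfadj :: "('x \<Rightarrow>\<^sub>L 'x) \<Rightarrow> bool"
  where "selfadj f \<longleftrightarrow> (\<forall>x y. ip (f x) y = ip x (f y))"

lemma selfadjD: "selfadj f \<Longrightarrow> ip (blinfun_apply f x) y = ip x (blinfun_apply f y)"
  by (simp add: selfadj_def)

lemma selfadj_id: "selfadj id_blinfun"
  by (simp add: selfadj_def)

lemma selfadj_add: "selfadj f \<Longrightarrow> selfadj g \<Longrightarrow> selfadj (f + g)"
  by (simp add: selfadj_def blinfun.bilinear_simps ip.add_left ip.add_right)

lemma selfadj_scaleR: "selfadj f \<Longrightarrow> selfadj (r *\<^sub>R f)"
  by (simp add: selfadj_def blinfun.bilinear_simps ip_scaleR_left ip_scaleR_right)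

lemma selfadj_diff: "selfadj f \<Longrightarrow> selfadj g \<Longrightarrow> selfadj (f - g)"
  by (simp add: selfadj_def blinfun.bilinear_simps ip.diff_left ip.diff_right)

lemma selfadj_compose:
  "selfadj f \<Longrightarrow> selfadj g \<Longrightarrow> (\<And>x. blinfun_apply f (blinfun_apply g x) = g (f x)) \<Longrightarrow> selfadj (f o\<^sub>L g)"
  by (simp add: selfadj_def)

lemma subspace_selfadj: "subspace {f. selfadj f}"
  using selfadj_id selfadj_scaleR[of _ 0]
  by (auto simp: subspace_def selfadj_add selfadj_scaleR)

lemma closed_selfadj: "closed {f. selfadj f}"
proof -
  have "{f. selfadj f} = (\<Inter>x. \<Inter>y. {f::'x \<Rightarrow>\<^sub>L 'x. ip (f x) y = ip x (f y)})"
    by (auto simp: selfadj_def)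
  then show ?thesis
    by (auto intro!: closed_INT closed_Collect_eq ip.continuous_on blinfun.continuous_on continuous_intros)
qed

text \<open>Closedness lets the commutant of \<open>g\<close> serve as \<open>P\<close> in
  \<open>blinfun_sqrt\<close>.\<close>

lemma closed_commute: "closed {f. \<forall>x. blinfun_apply g (blinfun_apply f x) = f (g x)}"
  for g :: "'x \<Rightarrow>\<^sub>L 'x"
proof -
  have "{f. \<forall>x. g (blinfun_apply f x) = f (g x)} = (\<Inter>x. {f. g (blinfun_apply f x) = f (g x)})"
    by auto
  then show ?thesis
    by (auto intro!: closed_INT closed_Collect_eq blinfun.continuous_on continuous_intros)
qed

definition nonneg :: "('x \<Rightarrow>\<^sub>L 'x) \<Rightarrow> bool"
  where "nonneg f \<longleftrightarrow> selfadj f \<and> (\<exists>t\<ge>0. norm (t *\<^sub>R id_blinfun - f) \<le> t)"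

lemma nonneg_selfadj: "nonneg f \<Longrightarrow> selfadj f"
  by (simp add: nonneg_def)

lemma nonnegI: "selfadj f \<Longrightarrow> norm (t *\<^sub>R id_blinfun - f) \<le> t \<Longrightarrow> nonneg f"
  unfolding nonneg_def by (intro conjI exI[of _ t]) (auto intro: order_trans[OF norm_ge_zero])

lemma nonneg_add:
  assumes "nonneg f" "nonneg g"
  shows "nonneg (f + g)"
proof -
  obtain s t where "norm (s *\<^sub>R id_blinfun - f) \<le> s" "norm (t *\<^sub>R id_blinfun - g) \<le> t"
    using assms by (auto simp: nonneg_def)
  then have "norm ((s *\<^sub>R id_blinfun - f) + (t *\<^sub>R id_blinfun - g)) \<le> s + t"
    by (rule norm_triangle_mono)
  also have "(s *\<^sub>R id_blinfun - f) + (t *\<^sub>R id_blinfun - g) = (s + t) *\<^sub>R id_blinfun - (f + g)"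
    by (simp add: scaleR_add_left)
  finally show ?thesis using assms by (simp add: nonnegI selfadj_add nonneg_selfadj)
qed

lemma nonneg_scaleR:
  assumes "nonneg f" "r \<ge> 0"
  shows "nonneg (r *\<^sub>R f)"
proof -
  obtain t where "norm (t *\<^sub>R id_blinfun - f) \<le> t" using assms by (auto simp: nonneg_def)
  then have "norm (r *\<^sub>R (t *\<^sub>R id_blinfun - f)) \<le> r * t"
    using assms by (simp add: mult_left_mono)
  then have "norm ((r * t) *\<^sub>R id_blinfun - r *\<^sub>R f) \<le> r * t"
    by (simp add: scaleR_diff_right)
  then show ?thesis using assms by (simp add: nonnegI selfadj_scaleR nonneg_selfadj)
qed

lemma nonneg_diff_of_norm_le: "selfadj f \<Longrightarrow> norm f \<le> t \<Longrightarrow> nonneg (t *\<^sub>R id_blinfun - f)"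
  by (rule nonnegI[where t=t]) (auto intro: selfadj_diff selfadj_scaleR selfadj_id)

section \<open>Roots and norm estimates for nonnegative operators\<close>

lemma nonneg_positive_bound:
  assumes "nonneg f"
  obtains t where "t > 0" "norm (t *\<^sub>R id_blinfun - f) \<le> t"
proof -
  obtain s where s: "s \<ge> 0" "norm (s *\<^sub>R id_blinfun - f) \<le> s" using assms by (auto simp: nonneg_def)
  have "(s + 1) *\<^sub>R id_blinfun - f = (s *\<^sub>R id_blinfun - f) + id_blinfun" by (simp add: scaleR_add_left)
  then have "norm ((s + 1) *\<^sub>R id_blinfun - f) \<le> s + 1"
    using norm_triangle_ineq[of "s *\<^sub>R id_blinfun - f" id_blinfun] s(2) norm_blinfun_id_le[where 'a='x]
    by (elim ssubst) linarith
  then show thesis using s(1) by (intro that[of "s + 1"]) auto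
qed

text \<open>After division by a positive bound \<open>t\<close>, \<open>blinfun_sqrt\<close>
  applies, and its root is rescaled by \<open>sqrt t\<close>. The closed subspaces fed into it are
  the selfadjoint operators and the commutant of \<open>g\<close>.\<close>

lemma nonneg_sqrt:
  assumes "nonneg f"
  obtains r :: "'x \<Rightarrow>\<^sub>L 'x" where "nonneg r" "r o\<^sub>L r = f"
    "\<forall>g. g o\<^sub>L f = f o\<^sub>L g \<longrightarrow> g o\<^sub>L r = r o\<^sub>L g"
proof -
  obtain t where t: "t > 0" "norm (t *\<^sub>R id_blinfun - f) \<le> t" using assms by (rule nonneg_positive_bound)
  define h where "h = (1/t) *\<^sub>R f"
  have "id_blinfun - h = (1/t) *\<^sub>R (t *\<^sub>R id_blinfun - f)"
    using t(1) by (simp add: h_def scaleR_diff_right)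
  then have "norm (id_blinfun - h) \<le> 1" using t by simp
  then show thesis
  proof (rule blinfun_sqrt)
    fix r :: "'x \<Rightarrow>\<^sub>L 'x"
    assume r: "\<And>x. r (r x) = h x" "norm (id_blinfun - r) \<le> 1"
      "\<And>P. closed P \<Longrightarrow> subspace P \<Longrightarrow> (\<And>f. f \<in> P \<Longrightarrow> f o\<^sub>L f \<in> P)
        \<Longrightarrow> id_blinfun \<in> P \<Longrightarrow> h \<in> P \<Longrightarrow> r \<in> P"
  have "r \<in> {f. selfadj f}"
    by (rule r(3)) (use assms in \<open>auto simp: h_def closed_selfadj subspace_selfadj selfadj_id
      intro: selfadj_compose selfadj_scaleR nonneg_selfadj\<close>)
  then have "nonneg r" using r(2) by (intro nonnegI[where t=1]) auto
  then have 1: "nonneg (sqrt t *\<^sub>R r)" using t by (simp add: nonneg_scaleR)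
  have 2: "sqrt t *\<^sub>R r o\<^sub>L sqrt t *\<^sub>R r = f"
    using t r(1) by (intro blinfun_eqI) (simp add: blinfun.bilinear_simps h_def)
  have 3: "g o\<^sub>L sqrt t *\<^sub>R r = sqrt t *\<^sub>R r o\<^sub>L g" if "g o\<^sub>L f = f o\<^sub>L g" for g :: "'x \<Rightarrow>\<^sub>L 'x"
  proof -
    have "r \<in> {f. \<forall>x. g (blinfun_apply f x) = f (g x)}"
      by (rule r(3)[OF closed_commute])
        (use that in \<open>auto simp: subspace_def h_def blinfun.bilinear_simps blinfun_compose_eq_iff\<close>)
    then show ?thesis by (auto intro!: blinfun_eqI simp: blinfun.bilinear_simps)
  qed
  show thesis by (rule that[OF 1 2]) (use 3 in blast)
  qed
qed

text \<open>The operators \<open>r \<plusminus> \<i> u\<close> are multiples of unitaries.\<close>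

lemma norm_le_of_square_sum:
  assumes r: "selfadj r" and u: "selfadj u"
    and comm: "\<And>x. blinfun_apply r (blinfun_apply u x) = blinfun_apply u (blinfun_apply r x)"
    and c: "c \<ge> 0" and sum: "\<And>x. blinfun_apply r (blinfun_apply r x) + blinfun_apply u (u x) = c *\<^sub>R x"
  shows "norm r \<le> sqrt c" "norm u \<le> sqrt c"
proof -
  \<comment> \<open>The cross terms in the inner squares of r x \<plusminus> \<i> u x cancel because
    \<open>r\<close> and \<open>u\<close> are selfadjoint and commute.\<close>
  have n: "norm (r x + \<i> *\<^sub>C u x) = sqrt c * norm x \<and> norm (r x - \<i> *\<^sub>C u x) = sqrt c * norm x" for x
  proof -
    have ru: "ip (r x) (u x) = ip (u x) (r x)"
      by (simp add: selfadjD[OF r] selfadjD[OF u] comm)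
    have s: "ip (r x) (r x) + ip (u x) (u x) = c *\<^sub>R ip x x"
      by (simp add: selfadjD[OF r] selfadjD[OF u] ip.add_right[symmetric] sum ip.scaleR_right)
    have "ip (r x + \<i> *\<^sub>C u x) (r x + \<i> *\<^sub>C u x) = c *\<^sub>R ip x x"
      using s ru by (simp add: ip.add_left ip.add_right ip_scaleC_left ip_scaleC_right scaleC_i_i
          scaleC_add_right scaleC_diff_right scaleC_minus_left algebra_simps)
    moreover have "ip (r x - \<i> *\<^sub>C u x) (r x - \<i> *\<^sub>C u x) = c *\<^sub>R ip x x"
      using s ru by (simp add: ip.diff_left ip.diff_right ip_scaleC_left ip_scaleC_right scaleC_i_i
          scaleC_add_right scaleC_diff_right scaleC_minus_left algebra_simps)
    ultimately show ?thesis using c by (simp add: norm_ip real_sqrt_mult)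
  qed
  have b: "norm (r x) \<le> sqrt c * norm x" "norm (u x) \<le> sqrt c * norm x" for x
  proof -
    have "2 *\<^sub>R r x = (r x + \<i> *\<^sub>C u x) + (r x - \<i> *\<^sub>C u x)" by (simp add: scaleR_2)
    from arg_cong[OF this, of norm] norm_triangle_ineq[of "r x + \<i> *\<^sub>C u x" "r x - \<i> *\<^sub>C u x"] n[of x]
    show "norm (r x) \<le> sqrt c * norm x" by simp
    have "2 *\<^sub>R (\<i> *\<^sub>C u x) = (r x + \<i> *\<^sub>C u x) - (r x - \<i> *\<^sub>C u x)" by (simp add: scaleR_2)
    from arg_cong[OF this, of norm] norm_triangle_ineq4[of "r x + \<i> *\<^sub>C u x" "r x - \<i> *\<^sub>C u x"] n[of x]
    show "norm (u x) \<le> sqrt c * norm x" by (simp add: norm_scaleC)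
  qed
  show "norm r \<le> sqrt c" "norm u \<le> sqrt c"
    using b c by (auto intro!: norm_blinfun_bound)
qed
 
text \<open>The root \<open>u\<close> of c - s^2 commutes with \<open>s\<close>, so
  \<open>norm_le_of_square_sum\<close> applies to s^2 + u^2 = c.\<close>

lemma norm_selfadj_le:
  assumes s: "selfadj s" and c: "c \<ge> 0" and le: "nonneg (c *\<^sub>R id_blinfun - (s o\<^sub>L s))"
  shows "norm s \<le> sqrt c"
proof -
  obtain u where u: "nonneg u" "u o\<^sub>L u = c *\<^sub>R id_blinfun - (s o\<^sub>L s)"
    and comm: "\<forall>g. g o\<^sub>L (c *\<^sub>R id_blinfun - (s o\<^sub>L s)) = (c *\<^sub>R id_blinfun - (s o\<^sub>L s)) o\<^sub>L g \<longrightarrow> g o\<^sub>L u = u o\<^sub>L g"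
    by (rule nonneg_sqrt[OF le])
  have "s o\<^sub>L u = u o\<^sub>L s" by (rule comm[rule_format]) (simp add: blinfun_compose_eq_iff blinfun.bilinear_simps)
  moreover have "u (u x) = c *\<^sub>R x - s (s x)" for x
    using arg_cong[OF u(2), of "\<lambda>f. blinfun_apply f x"] by (simp add: blinfun.bilinear_simps)
  ultimately show ?thesis
    using norm_le_of_square_sum(1)[OF s nonneg_selfadj[OF u(1)] _ c] by (simp add: blinfun_compose_eq_iff)
qed

text \<open>Let \<open>t\<close> be the square of \<open>norm r\<close> and \<open>u\<close> the
  root of t - r^2. Then r^2 + u^2 = t bounds \<open>norm u\<close> by \<open>sqrt t\<close>, so t -
  r^2 = u^2 has norm at most \<open>t\<close>, which is the bound required in
  \<open>nonneg\<close>.\<close>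

lemma nonneg_square:
  assumes r: "selfadj r"
  shows "nonneg (r o\<^sub>L r)"
proof -
  define t where "t = (norm r)\<^sup>2"
  have rr: "selfadj (r o\<^sub>L r)" using r by (simp add: selfadj_compose)
  have t: "norm (r o\<^sub>L r) \<le> t" "t \<ge> 0"
    using norm_blinfun_compose[of r r] by (simp_all add: t_def power2_eq_square)
  obtain u where u: "nonneg u" "u o\<^sub>L u = t *\<^sub>R id_blinfun - (r o\<^sub>L r)"
    and comm: "\<forall>g. g o\<^sub>L (t *\<^sub>R id_blinfun - (r o\<^sub>L r)) = (t *\<^sub>R id_blinfun - (r o\<^sub>L r)) o\<^sub>L g \<longrightarrow> g o\<^sub>L u = u o\<^sub>L g"
    by (rule nonneg_sqrt[OF nonneg_diff_of_norm_le[OF rr t(1)]])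
  have "r o\<^sub>L u = u o\<^sub>L r" by (rule comm[rule_format]) (simp add: blinfun_compose_eq_iff blinfun.bilinear_simps)
  moreover have "u (u x) = t *\<^sub>R x - r (r x)" for x
    using arg_cong[OF u(2), of "\<lambda>f. blinfun_apply f x"] by (simp add: blinfun.bilinear_simps)
  ultimately have "norm u \<le> sqrt t"
    using norm_le_of_square_sum(2)[OF r nonneg_selfadj[OF u(1)] _ t(2)] by (simp add: blinfun_compose_eq_iff)
  then have "norm u * norm u \<le> t"
    using mult_mono[of "norm u" "sqrt t" "norm u" "sqrt t"] t(2) by simp
  then have "norm (t *\<^sub>R id_blinfun - (r o\<^sub>L r)) \<le> t"
    using norm_blinfun_compose[of u u] by (simp add: u(2))
  then show ?thesis using rr by (rule nonnegI[rotated])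
qed

text \<open>Apply \<open>norm_selfadj_le\<close> to the square root of \<open>f\<close>.\<close>

lemma norm_nonneg_le:
  assumes f: "nonneg f" and c: "c \<ge> 0" and le: "nonneg (c *\<^sub>R id_blinfun - f)"
  shows "norm f \<le> c"
proof -
  obtain r where r: "nonneg r" and f_eq: "r o\<^sub>L r = f" by (rule nonneg_sqrt[OF f])
  have "norm r \<le> sqrt c" 
    using norm_selfadj_le[OF nonneg_selfadj[OF r] c] le by (simp add: f_eq)
  then have "norm r * norm r \<le> c"
    using mult_mono[of "norm r" "sqrt c" "norm r" "sqrt c"] c by simp
  then show ?thesis using norm_blinfun_compose[of r r] by (simp add: f_eq)
qed

lemma nonneg_antisym:
  assumes "nonneg f" "nonneg (- f)"
  shows "f = 0"
  using norm_nonneg_le[OF assms(1), of 0] assms(2) by simp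

lemma norm_nonneg_mono:
  assumes "nonneg f" "nonneg (g - f)"
  shows "norm f \<le> norm g"
proof (rule norm_nonneg_le[OF assms(1) norm_ge_zero])
  have "selfadj g" using selfadj_add[OF nonneg_selfadj[OF assms(1)] nonneg_selfadj[OF assms(2)]] by simp
  from nonneg_add[OF nonneg_diff_of_norm_le[OF this order_refl] assms(2)]
  show "nonneg (norm g *\<^sub>R id_blinfun - f)" by simp
qed

section \<open>Positivity of an operator composed with its adjoint\<close>

lemma selfadj_square_eq_0:
  assumes "selfadj f" "\<And>x. f (blinfun_apply f x) = 0"
  shows "f = 0"
proof (rule blinfun_eqI)
  fix x
  have "ip (f x) (f x) = 0" using assms by (simp add: selfadj_def ip.zero_right)
  then show "f x = blinfun_apply 0 x" using ip_definite by simp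
qed

text \<open>Kaplansky's argument. If \<open>c\<^sup>* c = - k\<close> with \<open>k = p\<^sup>2\<close>, then \<open>m = c c\<^sup>*\<close> is nonnegative,
  as \<open>c\<^sup>* c + c c\<^sup>*\<close> is a sum of squares. Since \<open>m c = - c k\<close>, a bound \<open>\<parallel>t - m\<parallel> \<le> t\<close> turns into
  \<open>\<parallel>c (t + k)\<parallel> \<le> t \<parallel>c\<parallel>\<close>, that is, \<open>\<parallel>p + p\<^sup>3 / t\<parallel> \<le> \<parallel>p\<parallel>\<close>, which forces \<open>p = 0\<close>.\<close>

lemma adjoint_compose_eq_minus_square:
  fixes C C' p :: "'x \<Rightarrow>\<^sub>L 'x"
  assumes adj: "\<And>x y. ip (C x) y = ip x (C' y)"
    and p: "selfadj p" and eq: "\<And>x. C' (C x) = - p (p x)"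
  shows "p = 0"
proof -
  have adj': "ip (C' x) y = ip x (C y)" for x y by (metis adj ip_star)
  define R where "R = C + C'"
  define D where "D = Blinfun (\<lambda>x. \<i> *\<^sub>C (C - C') x)"
  have "bounded_linear (\<lambda>x. \<i> *\<^sub>C (C - C') x)"
    by (rule bounded_linear_compose[OF bounded_linear_scaleC blinfun.bounded_linear_right])
  then have D: "D x = \<i> *\<^sub>C (C x - C' x)" for x
    by (simp add: D_def bounded_linear_Blinfun_apply blinfun.bilinear_simps)
  have R: "selfadj R"
    by (simp add: selfadj_def R_def blinfun.bilinear_simps ip.add_left ip.add_right adj adj')
  have "selfadj D"
    by (simp add: selfadj_def D blinfun.bilinear_simps ip_scaleC_left ip_scaleC_right ip.diff_left ip.diff_right
        adj adj' scaleC_minus_left scaleC_diff_right)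
  define M where "M = C o\<^sub>L C'"
  \<comment> \<open>Up to sign, \<open>R\<close> and \<open>D\<close> are twice the real and
    imaginary parts of \<open>C\<close>, so C C' + C' C is half of R^2 + D^2. Then insert C' C = -
    p^2.\<close>
  have "C o\<^sub>L C' = (1/2) *\<^sub>R (R o\<^sub>L R) + (1/2) *\<^sub>R (D o\<^sub>L D) + (p o\<^sub>L p)"
  proof (rule blinfun_eqI)
    fix x
    note lin = blinfun.bilinear_simps adjoint_scaleC[OF adj] scaleC_diff_right scaleC_i_i
    have "2 *\<^sub>R blinfun_apply (C o\<^sub>L C') x = R (R x) + D (D x) + 2 *\<^sub>R p (p x)"
      using eq[of x] by (simp add: R_def D lin scaleR_2 algebra_simps)
    then have "(1/2) *\<^sub>R (2 *\<^sub>R blinfun_apply (C o\<^sub>L C') x) = (1/2) *\<^sub>R (R (R x) + D (D x) + 2 *\<^sub>R p (p x))"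
      by simp
    then show "(C o\<^sub>L C') x = blinfun_apply ((1/2) *\<^sub>R (R o\<^sub>L R) + (1/2) *\<^sub>R (D o\<^sub>L D) + (p o\<^sub>L p)) x"
      by (simp add: blinfun.bilinear_simps scaleR_add_right)
  qed
  then have "nonneg M"
    unfolding M_def by (simp add: nonneg_add nonneg_scaleR nonneg_square R \<open>selfadj D\<close> p)
  then obtain t where t: "t > 0" "norm (t *\<^sub>R id_blinfun - M) \<le> t" by (rule nonneg_positive_bound)
  define s where "s = p + (1/t) *\<^sub>R (p o\<^sub>L p o\<^sub>L p)"
  have k: "selfadj (p o\<^sub>L p)" using p by (simp add: selfadj_compose)
  have s: "selfadj s"
    unfolding s_def using p by (intro selfadj_add selfadj_scaleR selfadj_compose) auto
  have norm_C: "norm (C x) = norm (p x)" for x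
  proof -
    have "ip (C x) (C x) = - ip (p x) (p x)"
      by (simp add: adj eq selfadjD[OF p] ip.minus_right)
    then show ?thesis by (simp add: norm_ip)
  qed
  \<comment> \<open>From C' C = - p^2 follows C (t + p^2) = (t - M) C, and \<open>norm_C\<close>
    exchanges \<open>C\<close> for \<open>p\<close> under the norm. The bound for t - M thus becomes
    one for t s = p (t + p^2).\<close>
  have "norm (s x) \<le> norm p * norm x" for x
  proof -
    have "t *\<^sub>R s x = p (t *\<^sub>R x + p (p x))"
      using t(1) by (simp add: s_def blinfun.bilinear_simps scaleR_add_right)
    then have "t * norm (s x) = norm (C (t *\<^sub>R x + p (p x)))"
      using t(1) by (metis norm_C norm_scaleR abs_of_pos)
    also have "C (t *\<^sub>R x + p (p x)) = (t *\<^sub>R id_blinfun - M) (C x)"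
      by (simp add: M_def blinfun.bilinear_simps eq)
    also have "norm \<dots> \<le> t * norm (C x)"
      using norm_blinfun t(2) by (meson mult_right_mono norm_ge_zero order_trans)
    also have "\<dots> \<le> t * (norm p * norm x)"
      using t(1) norm_blinfun[of p x] by (simp add: norm_C)
    finally show ?thesis using t(1) by simp
  qed
  then have norm_s: "norm s \<le> norm p" by (intro norm_blinfun_bound) auto
  define c where "c = (norm p)\<^sup>2"
  define \<rho> where "\<rho> = sqrt (t * c + t\<^sup>2 / 4)"
  have c: "c \<ge> 0" by (simp add: c_def)
  \<comment> \<open>\<open>q\<close> completes the square. As t s^2 = t p^2 + 2 p^4 + p^6 / t,
    adding p^4 + p^6 / t to t (c - s^2) leaves t c - t p^2 - p^4 = t c + t^2 / 4 - q^2.\<close>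
  define q where "q = (p o\<^sub>L p) + (t/2) *\<^sub>R id_blinfun"
  have q: "selfadj q" unfolding q_def by (intro selfadj_add selfadj_scaleR selfadj_id k)
  have "nonneg (t *\<^sub>R (c *\<^sub>R id_blinfun - (s o\<^sub>L s)) + ((p o\<^sub>L p) o\<^sub>L (p o\<^sub>L p))
      + (1/t) *\<^sub>R ((p o\<^sub>L p o\<^sub>L p) o\<^sub>L (p o\<^sub>L p o\<^sub>L p)))"
  proof (intro nonneg_add nonneg_scaleR nonneg_square k nonneg_diff_of_norm_le)
    show "norm (s o\<^sub>L s) \<le> c"
      using norm_blinfun_compose[of s s] mult_mono[OF norm_s norm_s] by (simp add: c_def power2_eq_square)
  qed (use p s t in \<open>auto intro!: selfadj_compose\<close>)
  also have "t *\<^sub>R (c *\<^sub>R id_blinfun - (s o\<^sub>L s)) + ((p o\<^sub>L p) o\<^sub>L (p o\<^sub>L p))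
      + (1/t) *\<^sub>R ((p o\<^sub>L p o\<^sub>L p) o\<^sub>L (p o\<^sub>L p o\<^sub>L p)) = (t * c + t\<^sup>2/4) *\<^sub>R id_blinfun - (q o\<^sub>L q)"
    using t(1)
    by (intro blinfun_eqI)
      (simp add: s_def q_def blinfun.bilinear_simps power2_eq_square algebra_simps, simp flip: scaleR_add_left)
  finally have "norm q \<le> \<rho>"
    unfolding \<rho>_def using q t(1) c by (intro norm_selfadj_le) auto
  from nonneg_diff_of_norm_le[OF q this]
  have "nonneg ((\<rho> - t/2) *\<^sub>R id_blinfun - (p o\<^sub>L p))"
    by (simp add: q_def scaleR_diff_left algebra_simps)
  moreover have "\<rho> \<ge> t/2"
    unfolding \<rho>_def using c t(1) by (intro real_le_rsqrt) (simp add: power2_eq_square)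
  ultimately have "norm p \<le> sqrt (\<rho> - t/2)"
    using p by (intro norm_selfadj_le) auto
  \<comment> \<open>Squaring c + t/2 \<le> \<rho> gives (c + t/2)^2 \<le> t c + t^2 / 4, that is,
    c^2 \<le> 0.\<close>
  then have "c \<le> \<rho> - t/2"
    using \<open>\<rho> \<ge> t/2\<close> power_mono[of "norm p" "sqrt (\<rho> - t/2)" 2] by (simp add: c_def)
  then have "(c + t/2)\<^sup>2 \<le> \<rho>\<^sup>2" using c t(1) by (intro power_mono) auto
  also have "\<rho>\<^sup>2 = t * c + t\<^sup>2 / 4" using c t(1) by (simp add: \<rho>_def)
  finally have "c\<^sup>2 \<le> 0" by (simp add: power2_eq_square field_simps)
  then show ?thesis by (simp add: c_def)
qed

text \<open>With \<open>g = \<bar>h\<bar> - h\<close> and \<open>p = \<bar>h\<bar>\<^sup>1\<^sup>/\<^sup>2 g\<close> one has \<open>g h g = - p\<^sup>2\<close>.\<close>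

lemma negative_part:
  assumes h: "selfadj h"
  obtains g p where "selfadj g" "selfadj p" "\<forall>x. blinfun_apply g (blinfun_apply h (g x)) = - p (blinfun_apply p x)"
    "p = 0 \<longrightarrow> nonneg h"
proof -
  have "nonneg (h o\<^sub>L h)" using h by (rule nonneg_square)
  then obtain m where m: "nonneg m" "m o\<^sub>L m = h o\<^sub>L h"
    and m_comm: "\<forall>g. g o\<^sub>L (h o\<^sub>L h) = (h o\<^sub>L h) o\<^sub>L g \<longrightarrow> g o\<^sub>L m = m o\<^sub>L g"
    by (rule nonneg_sqrt)
  obtain q where q: "nonneg q" "q o\<^sub>L q = m"
    and q_comm: "\<forall>g. g o\<^sub>L m = m o\<^sub>L g \<longrightarrow> g o\<^sub>L q = q o\<^sub>L g"
    by (rule nonneg_sqrt[OF m(1)])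
  have mm: "m (m x) = h (h x)" for x using m(2) by (simp add: blinfun_compose_eq_iff)
  have qq: "q (q x) = m x" for x using q(2) by auto
  have hm': "h o\<^sub>L m = m o\<^sub>L h" by (rule m_comm[rule_format]) (simp add: blinfun_compose_eq_iff)
  have "h o\<^sub>L q = q o\<^sub>L h" by (rule q_comm[rule_format]) (rule hm')
  moreover have "m o\<^sub>L q = q o\<^sub>L m" by (rule q_comm[rule_format]) simp
  ultimately have hm: "h (m x) = m (h x)" and hq: "h (q x) = q (h x)" and mq: "m (q x) = q (m x)" for x
    using hm' by (simp_all add: blinfun_compose_eq_iff)
  define g where "g = m - h"
  define p where "p = q o\<^sub>L g"
  have gq: "g (q x) = q (g x)" for x by (simp add: g_def blinfun.bilinear_simps hq mq)
  have g: "selfadj g" using h m by (simp add: g_def selfadj_diff nonneg_selfadj)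
  show thesis
  proof (rule that[of g p])
    show "selfadj g" by (rule g)
    show "selfadj p" unfolding p_def using g nonneg_selfadj[OF q(1)] by (intro selfadj_compose) (simp_all add: gq)
    \<comment> \<open>Since m^2 = h^2 and \<open>m\<close> commutes with \<open>h\<close>, (m - h) h
      = - m (m - h).\<close>
    have "g (h y) = - m (g y)" for y
      using mm[of y] by (simp add: g_def blinfun.bilinear_simps hm)
    then show "\<forall>x. g (h (g x)) = - p (p x)"
      by (simp add: p_def gq qq)
  next
    \<comment> \<open>Here m g = q p = 0, hence h g = - m g = 0 and g^2 = 0, so that
      \<open>h = m\<close>.\<close>
    have "nonneg h" if "p = 0"
    proof -
    from that have "m (g x) = 0" for x
      using qq[of "g x"] by (metis p_def blinfun_apply_blinfun_compose blinfun.zero_left blinfun.zero_right)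
    then have "g (g x) = 0" for x
      using mm[of x] by (simp add: g_def blinfun.bilinear_simps hm)
    then have "g = 0" by (rule selfadj_square_eq_0[OF g])
    then show "nonneg h" using m by (simp add: g_def)
    qed
    then show "p = 0 \<longrightarrow> nonneg h" ..
  qed
qed

text \<open>\<open>negative_part\<close> for C' C provides \<open>g\<close> and \<open>p\<close>
  with (g C') (C g) = - p^2. As g C' is the adjoint of C g,
  \<open>adjoint_compose_eq_minus_square\<close> forces \<open>p = 0\<close>.\<close>

theorem nonneg_adjoint_compose:
  fixes C C' :: "'x \<Rightarrow>\<^sub>L 'x"
  assumes adj: "\<And>x y. ip (C x) y = ip x (C' y)"
  shows "nonneg (C' o\<^sub>L C)"
proof -
  have adj': "ip (C' x) y = ip x (C y)" for x y by (metis adj ip_star)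
  have "selfadj (C' o\<^sub>L C)" by (simp add: selfadj_def adj adj')
  then obtain g p where g: "selfadj g" and p: "selfadj p"
    "\<forall>x. blinfun_apply g ((C' o\<^sub>L C) (blinfun_apply g x)) = - blinfun_apply p (blinfun_apply p x)" "p = 0 \<longrightarrow> nonneg (C' o\<^sub>L C)"
    by (rule negative_part)
  have "p = 0"
    by (rule adjoint_compose_eq_minus_square[of "C o\<^sub>L g" "g o\<^sub>L C'"]) (use p in \<open>simp_all add: adj selfadjD[OF g]\<close>)
  then show ?thesis using p by simp
qed

text \<open>The bound in \<open>nonneg\<close> can be taken to be \<open>norm f\<close>, by
  \<open>norm_nonneg_le\<close> for the operator norm f - f. This turns the existential condition
  into a closed one.\<close>

lemma closed_nonneg: "closed {f. nonneg f}"
proof -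
  have *: "nonneg f \<longleftrightarrow> selfadj f \<and> norm (norm f *\<^sub>R id_blinfun - f) \<le> norm f" for f
  proof
    assume f: "nonneg f"
    then have "nonneg (norm f *\<^sub>R id_blinfun - f)"
      by (simp add: nonneg_diff_of_norm_le nonneg_selfadj)
    then show "selfadj f \<and> norm (norm f *\<^sub>R id_blinfun - f) \<le> norm f"
      using norm_nonneg_le[of _ "norm f"] f by (simp add: nonneg_selfadj)
  qed (auto intro: nonnegI)
  have "{f. nonneg f} = {f. selfadj f} \<inter> {f. norm (norm f *\<^sub>R id_blinfun - f) \<le> norm f}"
    using * by auto
  then show ?thesis
    by (auto intro!: closed_Int closed_selfadj closed_Collect_le continuous_intros)
qed

text \<open>The value is the inner square of \<open>r x\<close> for a root \<open>r\<close> of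
  \<open>f\<close>. This is the way back from operators to \<open>cpos\<close>.\<close>

lemma cpos_ip_of_nonneg:
  assumes "nonneg f"
  shows "cpos (ip x (f x))"
proof -
  obtain r where r: "nonneg r" "r o\<^sub>L r = f" by (rule nonneg_sqrt[OF assms])
  have "ip x (f x) = ip (r x) (r x)"
    using r(2) selfadjD[OF nonneg_selfadj[OF r(1)]] by auto
  then show ?thesis using ip_pos by simp
qed

end

subsection \<open>The order of a C*-algebra\<close>

text \<open>As a Hilbert module over itself, the algebra has the operator results available for its
  multiplication operators.\<close>

interpretation alg: hilbert_module "(*)" "alg_ip :: 'a::cstar_algebra \<Rightarrow> 'a \<Rightarrow> 'a"
proof
  show "norm x = sqrt (norm (alg_ip x x))" for x :: 'a
    by (simp add: alg_ip_def norm_star_mult)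
  show "alg_ip x x = 0 \<Longrightarrow> x = 0" for x :: 'a
    using norm_star_mult[of x] by (simp add: alg_ip_def)
  show "cpos (alg_ip x x)" for x :: 'a
    by (auto simp: cpos_def alg_ip_def)
qed (simp_all add: alg_ip_def algebra_simps mult_scaleC_left mult_scaleC_right star_mult star_star)

text \<open>\<open>blinfun_mult_right a\<close> is left multiplication by \<open>a\<close>.
  Positivity of this operator makes sense without a unit and brings along sums, limits and norm
  estimates.\<close>

definition apos :: "'a::cstar_algebra \<Rightarrow> bool"
  where "apos a \<longleftrightarrow> alg.nonneg (blinfun_mult_right a)"

text \<open>The lower estimate comes from the C*-identity, by evaluation at
  \<open>star a\<close>.\<close>

lemma norm_blinfun_mult_right: "norm (blinfun_mult_right a) = norm (a::'a::cstar_algebra)"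
proof (rule antisym)
  show "norm (blinfun_mult_right a) \<le> norm a"
    by (rule norm_blinfun_bound) (simp_all add: norm_mult_ineq)
  have "norm a * norm a = norm (a * star a)"
    using norm_star_mult[of "star a"] by (simp add: star_star norm_star power2_eq_square)
  also have "\<dots> \<le> norm (blinfun_mult_right a) * norm a"
    using norm_blinfun[of "blinfun_mult_right a" "star a"] by (simp add: norm_star)
  finally show "norm a \<le> norm (blinfun_mult_right a)"
    by (cases "a = 0") auto
qed

text \<open>Left multiplication by \<open>star a\<close> is adjoint to left multiplication by
  \<open>a\<close>.\<close>

lemma apos_star_mult_self: "apos (star a * a)"
proof -
  have "alg.nonneg (blinfun_mult_right (star a) o\<^sub>L blinfun_mult_right a)"
    by (rule alg.nonneg_adjoint_compose) (simp add: alg_ip_def star_mult mult.assoc)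
  also have "blinfun_mult_right (star a) o\<^sub>L blinfun_mult_right a = blinfun_mult_right (star a * a)"
    by (rule blinfun_eqI) (simp add: mult.assoc)
  finally show ?thesis by (simp add: apos_def)
qed

lemma cpos_imp_apos: "cpos a \<Longrightarrow> apos a"
  by (auto simp: cpos_def apos_star_mult_self)

lemmas blinfun_mult_right_simps =
  linear_add[OF bounded_linear.linear[OF bounded_linear_blinfun_mult_right]]
  linear_diff[OF bounded_linear.linear[OF bounded_linear_blinfun_mult_right]]
  linear_neg[OF bounded_linear.linear[OF bounded_linear_blinfun_mult_right]]
  linear_scale[OF bounded_linear.linear[OF bounded_linear_blinfun_mult_right]]
  linear_0[OF bounded_linear.linear[OF bounded_linear_blinfun_mult_right]]

lemma apos_add: "apos a \<Longrightarrow> apos b \<Longrightarrow> apos (a + b)"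
  by (simp add: apos_def blinfun_mult_right_simps alg.nonneg_add)

lemma apos_scaleR: "apos a \<Longrightarrow> r \<ge> 0 \<Longrightarrow> apos (r *\<^sub>R a)"
  by (simp add: apos_def blinfun_mult_right_simps alg.nonneg_scaleR)

lemma apos_zero: "apos 0"
  using apos_star_mult_self[of 0] by simp

lemma apos_antisym: "apos a \<Longrightarrow> apos (- a) \<Longrightarrow> a = 0"
  using alg.nonneg_antisym[of "blinfun_mult_right a"] norm_blinfun_mult_right[of a]
  by (simp add: apos_def blinfun_mult_right_simps)

lemma norm_apos_mono: "apos a \<Longrightarrow> apos (b - a) \<Longrightarrow> norm a \<le> norm b"
  using alg.norm_nonneg_mono[of "blinfun_mult_right a" "blinfun_mult_right b"]
  by (simp add: apos_def blinfun_mult_right_simps norm_blinfun_mult_right)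

lemma apos_sum: "(\<And>i. i \<in> I \<Longrightarrow> apos (f i)) \<Longrightarrow> apos (\<Sum>i\<in>I. f i)"
  by (induction I rule: infinite_finite_induct) (auto simp: apos_zero apos_add)

lemma apos_LIMSEQ:
  assumes "X \<longlonglongrightarrow> a" "eventually (\<lambda>n. apos (X n)) sequentially"
  shows "apos a"
proof -
  have "(\<lambda>n. blinfun_mult_right (X n)) \<longlonglongrightarrow> blinfun_mult_right a"
    by (rule bounded_linear.tendsto[OF bounded_linear_blinfun_mult_right assms(1)])
  then have "blinfun_mult_right a \<in> {f. alg.nonneg f}"
    by (rule Lim_in_closed_set[OF alg.closed_nonneg _ sequentially_bot, rotated])
      (use assms(2) in \<open>simp add: apos_def\<close>)
  then show ?thesis by (simp add: apos_def)
qed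

lemma apos_suminf_diff_sum:
  assumes "summable f" "\<And>n. apos (f n)" "finite F"
  shows "apos ((\<Sum>n. f n) - (\<Sum>n\<in>F. f n))"
proof (rule apos_LIMSEQ)
  show "(\<lambda>N. (\<Sum>n<N. f n) - (\<Sum>n\<in>F. f n)) \<longlonglongrightarrow> (\<Sum>n. f n) - (\<Sum>n\<in>F. f n)"
    by (intro tendsto_diff tendsto_const summable_LIMSEQ assms)
  obtain N where N: "F \<subseteq> {..<N}" using assms(3) finite_nat_iff_bounded by blast
  have "apos ((\<Sum>n<k. f n) - (\<Sum>n\<in>F. f n))" if "k \<ge> N" for k
  proof -
    have "F \<subseteq> {..<k}" using N that by force
    then have "(\<Sum>n<k. f n) - (\<Sum>n\<in>F. f n) = (\<Sum>n\<in>{..<k} - F. f n)"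
      by (simp add: sum_diff)
    then show ?thesis using assms(2) by (simp add: apos_sum)
  qed
  then show "\<forall>\<^sub>F k in sequentially. apos ((\<Sum>n<k. f n) - (\<Sum>n\<in>F. f n))"
    using eventually_sequentially by blast
qed

lemma apos_suminf:
  assumes "summable f" "\<And>n. apos (f n)"
  shows "apos (\<Sum>n. f n)"
  using apos_suminf_diff_sum[OF assms, of "{}"] by simp

text \<open>An additive Cauchy-Schwarz inequality. The parallelogram law bounds each of the four
  terms of the polarization identity, and the weight \<open>s\<close> arises by rescaling
  \<open>a\<close> and \<open>b\<close>. The choice of \<open>s\<close> later allows one of the two
  terms to be absorbed.\<close>

lemma norm_sum_star_mult_le:
  fixes a b :: "nat \<Rightarrow> 'a::cstar_algebra"
  assumes s: "s > 0"
  shows "norm (\<Sum>n\<in>F. star (a n) * b n)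
    \<le> 2 * (s * norm (\<Sum>n\<in>F. star (a n) * a n) + norm (\<Sum>n\<in>F. star (b n) * b n) / s)"
proof -
  have *: "norm (\<Sum>n\<in>F. star (u n) * v n)
    \<le> 2 * (norm (\<Sum>n\<in>F. star (u n) * u n) + norm (\<Sum>n\<in>F. star (v n) * v n))" for u v :: "nat \<Rightarrow> 'a"
  proof -
    define Q where "Q w = (\<Sum>n\<in>F. alg_ip (w n) (w n))" for w :: "nat \<Rightarrow> 'a"
    have Q_pos: "apos (Q w)" for w by (simp add: Q_def alg_ip_def apos_sum apos_star_mult_self)
    have parallelogram: "Q (\<lambda>n. u n + w n) + Q (\<lambda>n. u n - w n) = 2 *\<^sub>R (Q u + Q w)" for w
      unfolding Q_def by (simp add: sum.distrib[symmetric] scaleR_sum_right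
          alg.ip.add_left alg.ip.add_right alg.ip.diff_left alg.ip.diff_right scaleR_2)
    have bound: "norm (Q (\<lambda>n. u n + c *\<^sub>C v n)) \<le> 2 * (norm (Q u) + norm (Q v))" if c: "cmod c = 1" for c
    proof -
      have "cnj c * c = of_real ((cmod c)\<^sup>2)" by (simp only: complex_norm_square mult.commute)
      then have "cnj c * c = 1" using c by simp
      then have "Q (\<lambda>n. c *\<^sub>C v n) = Q v"
        by (simp add: Q_def alg.ip_scaleC_left alg.ip_scaleC_right scaleC_scaleC mult.commute)
      then have "2 *\<^sub>R (Q u + Q v) = Q (\<lambda>n. u n + c *\<^sub>C v n) + Q (\<lambda>n. u n - c *\<^sub>C v n)"
        using parallelogram[of "\<lambda>n. c *\<^sub>C v n"] by simp
      then have "norm (Q (\<lambda>n. u n + c *\<^sub>C v n)) \<le> norm (2 *\<^sub>R (Q u + Q v))"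
        by (intro norm_apos_mono) (simp_all only: Q_pos add_diff_cancel_left')
      then show ?thesis using norm_triangle_ineq[of "Q u" "Q v"] by simp
    qed
    have i: "norm (\<i> *\<^sub>C a) = norm a" for a :: 'a by (simp add: norm_scaleC)
    have eq: "4 *\<^sub>R (\<Sum>n\<in>F. alg_ip (u n) (v n)) = Q (\<lambda>n. u n + v n) - Q (\<lambda>n. u n - v n)
        - \<i> *\<^sub>C Q (\<lambda>n. u n + \<i> *\<^sub>C v n) + \<i> *\<^sub>C Q (\<lambda>n. u n - \<i> *\<^sub>C v n)"
      unfolding scaleR_sum_right alg.polarization Q_def
      by (simp add: sum.distrib sum_subtractf linear_sum[OF bounded_linear.linear[OF bounded_linear_scaleC]])
    have "norm (4 *\<^sub>R (\<Sum>n\<in>F. alg_ip (u n) (v n))) \<le> norm (Q (\<lambda>n. u n + v n)) + norm (Q (\<lambda>n. u n - v n))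
      + norm (\<i> *\<^sub>C Q (\<lambda>n. u n + \<i> *\<^sub>C v n)) + norm (\<i> *\<^sub>C Q (\<lambda>n. u n - \<i> *\<^sub>C v n))"
      unfolding eq by (intro order_trans[OF norm_triangle_ineq] add_mono order_trans[OF norm_triangle_ineq4] order_refl)
    also have "\<dots> \<le> 8 * (norm (Q u) + norm (Q v))"
      unfolding i using bound[of 1] bound[of "-1"] bound[of \<i>] bound[of "-\<i>"] by (simp add: scaleC_minus_left)
    finally show ?thesis by (simp add: Q_def alg_ip_def)
  qed
  have "norm (\<Sum>n\<in>F. star (sqrt s *\<^sub>R a n) * ((1 / sqrt s) *\<^sub>R b n))
    \<le> 2 * (norm (\<Sum>n\<in>F. star (sqrt s *\<^sub>R a n) * (sqrt s *\<^sub>R a n))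
        + norm (\<Sum>n\<in>F. star ((1 / sqrt s) *\<^sub>R b n) * ((1 / sqrt s) *\<^sub>R b n)))"
    by (rule *)
  then show ?thesis using s by (simp add: star_scaleR flip: scaleR_sum_right)
qed

section \<open>Positivity tested on vectors, and boundedness of symmetric maps\<close>

context hilbert_module
begin

text \<open>With \<open>g\<close> and \<open>p\<close> from \<open>negative_part\<close>, the form
  at \<open>g x\<close> takes the value \<open>- ip (p x) (p x)\<close>, which is then both positive
  and negative; so \<open>p = 0\<close>.\<close>

lemma nonneg_of_apos:
  assumes h: "selfadj h" and pos: "\<And>x. apos (ip x (h x))"
  shows "nonneg h"
proof -
  obtain g p where g: "selfadj g" and p: "selfadj p"
    "\<forall>x. g (h (g x)) = - p (blinfun_apply p x)" "p = 0 \<longrightarrow> nonneg h"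
    by (rule negative_part[OF h])
  have "p x = 0" for x
  proof -
    have "ip (g x) (h (g x)) = - ip (p x) (p x)"
      using p(2) by (simp add: selfadjD[OF g] selfadjD[OF p(1)] ip.minus_right)
    then have "apos (- ip (p x) (p x))" using pos[of "g x"] by simp
    with cpos_imp_apos[OF ip_pos] have "ip (p x) (p x) = 0" by (rule apos_antisym)
    then show ?thesis by (rule ip_definite)
  qed
  then have "p = 0" by (simp add: blinfun_eqI)
  then show ?thesis using p by simp
qed

text \<open>The Hellinger--Toeplitz theorem, by Baire's theorem applied to the closed sets
  \<open>{x. \<forall>y. \<parallel>y\<parallel> \<le> 1 \<longrightarrow> \<parallel>\<langle>f y, x\<rangle>\<parallel> \<le> k}\<close>.\<close>

lemma bounded_linear_of_symmetric:
  assumes sym: "\<And>x y. ip (f x) y = ip x (f y)"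
  shows "bounded_linear f"
proof -
  have add: "f (x + y) = f x + f y" for x y
    by (rule ip_eqI) (simp add: sym[symmetric] ip.add_right)
  have scale: "f (r *\<^sub>R x) = r *\<^sub>R f x" for r x
    by (rule ip_eqI) (simp add: sym[symmetric] ip.scaleR_right)
  define S where "S k = {x. \<forall>y. norm y \<le> 1 \<longrightarrow> norm (ip (f y) x) \<le> real k}" for k :: nat
  have closed: "closed (S k)" for k
  proof -
    have "S k = (\<Inter>y\<in>{y. norm y \<le> 1}. {x. norm (ip (f y) x) \<le> real k})" by (auto simp: S_def)
    then show ?thesis
      by (auto intro!: closed_INT closed_Collect_le continuous_intros ip.continuous_on)
  qed
  have cover: "\<exists>k. x \<in> S k" for x
  proof -
    obtain k :: nat where k: "4 * norm (f x) \<le> real k" using real_arch_simple by blast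
    have "norm (ip (f y) x) \<le> real k" if "norm y \<le> 1" for y
      using norm_ip_le[of y "f x"] k mult_right_mono[OF that, of "norm (f x)"] by (simp add: sym)
    then show ?thesis by (auto simp: S_def)
  qed
  have "\<exists>k. interior (S k) \<noteq> {}"
  proof (rule ccontr)
    assume *: "\<not> (\<exists>k. interior (S k) \<noteq> {})"
    have "euclidean interior_of \<Union> (range S) = {}"
    proof (rule Baire_category_alt)
      fix T assume "T \<in> range S"
      then show "closedin euclidean T \<and> euclidean interior_of T = {}"
        using closed * by (metis closed_closedin euclidean_interior_of imageE)
    qed (simp_all add: completely_metrizable_space_euclidean)
    moreover have "\<Union> (range S) = UNIV" using cover by auto
    ultimately show False by simp
  qed
  then obtain k x0 where "x0 \<in> interior (S k)" by blast
  then obtain e where e: "e > 0" "ball x0 e \<subseteq> S k" by (auto simp: mem_interior)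
  \<comment> \<open>Both \<open>x0\<close> and \<open>x0 + x\<close> lie in \<open>S k\<close>;
    taking the difference moves the bound to a ball around 0 and doubles it.\<close>
  have unit: "norm (ip y (f x)) \<le> 2 * real k" if "norm x < e" "norm y \<le> 1" for x y
  proof -
    have "x0 \<in> S k" "x0 + x \<in> S k" using e that by (auto simp: dist_norm)
    then have "norm (ip (f y) (x0 + x)) \<le> real k" "norm (ip (f y) x0) \<le> real k"
      using that(2) by (auto simp: S_def)
    moreover have "ip y (f x) = ip (f y) (x0 + x) - ip (f y) x0"
      by (simp add: ip.add_right sym)
    ultimately show ?thesis using norm_triangle_ineq4[of "ip (f y) (x0 + x)" "ip (f y) x0"] by simp
  qed
  have ball: "norm (f x) \<le> 2 * real k" if "norm x < e" for x
  proof (cases "f x = 0")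
    case False
    have "norm (ip ((1 / norm (f x)) *\<^sub>R f x) (f x)) = norm (f x)"
      using False by (simp add: ip.scaleR_left norm_ip_self power2_eq_square)
    then show ?thesis using unit[of x "(1 / norm (f x)) *\<^sub>R f x"] that False by simp
  qed simp
  have "norm (f x) \<le> norm x * (4 * real k / e)" for x
  proof (cases "x = 0")
    case True
    then show ?thesis using scale[of 0 0] by simp
  next
    case False
    have "norm (f ((e / (2 * norm x)) *\<^sub>R x)) \<le> 2 * real k"
      using False e(1) by (intro ball) simp
    then show ?thesis using False e(1) by (simp add: scale field_simps)
  qed
  then show ?thesis using add scale by (rule bounded_linear_intro[rotated -1])
qed

end

subsection \<open>Square summable sequences\<close>

lemma ell2_Cauchy:
  assumes "a \<in> ell2" "e > 0"
  obtains N where "\<forall>m\<ge>N. \<forall>n. norm (\<Sum>k=m..<n. star (a k) * a k) < e"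
  using assms unfolding ell2_def summable_Cauchy by blast

text \<open>Cauchy's criterion follows from \<open>norm_sum_star_mult_le\<close> with weight 1, as 2
  (e/4 + e/4) = e.\<close>

lemma summable_star_mult:
  assumes "a \<in> ell2" "b \<in> ell2"
  shows "summable (\<lambda>n. star (a n) * b n)"
  unfolding summable_Cauchy
proof (intro allI impI)
  fix e :: real assume e: "e > 0"
  then have "e / 4 > 0" by simp
  obtain N where N: "\<forall>m\<ge>N. \<forall>n. norm (\<Sum>k=m..<n. star (a k) * a k) < e / 4"
    by (rule ell2_Cauchy[OF assms(1) \<open>e / 4 > 0\<close>])
  obtain M where M: "\<forall>m\<ge>M. \<forall>n. norm (\<Sum>k=m..<n. star (b k) * b k) < e / 4"
    by (rule ell2_Cauchy[OF assms(2) \<open>e / 4 > 0\<close>])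
  have "norm (\<Sum>k=m..<n. star (a k) * b k) < e" if "m \<ge> max M N" for m n
    using norm_sum_star_mult_le[of 1 a b "{m..<n}"] N[rule_format, of m n] M[rule_format, of m n] that by simp
  then show "\<exists>N. \<forall>m\<ge>N. \<forall>n. norm (\<Sum>k=m..<n. star (a k) * b k) < e" by blast
qed

lemma ell2_ip_sums: "a \<in> ell2 \<Longrightarrow> b \<in> ell2 \<Longrightarrow> (\<lambda>n. star (a n) * b n) sums ell2_ip a b"
  unfolding ell2_ip_def by (rule summable_sums) (rule summable_star_mult)

lemma star_ell2_ip:
  assumes "a \<in> ell2" "b \<in> ell2"
  shows "star (ell2_ip a b) = ell2_ip b a"
proof (rule sums_unique2)
  show "(\<lambda>n. star (star (a n) * b n)) sums star (ell2_ip a b)"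
    by (rule bounded_linear.sums[OF bounded_linear_star ell2_ip_sums[OF assms]])
  show "(\<lambda>n. star (star (a n) * b n)) sums ell2_ip b a"
    using ell2_ip_sums[OF assms(2,1)] by (simp add: star_mult star_star)
qed

lemma ell2_ip_add_right:
  "a \<in> ell2 \<Longrightarrow> b \<in> ell2 \<Longrightarrow> c \<in> ell2 \<Longrightarrow> ell2_ip a (b + c) = ell2_ip a b + ell2_ip a c"
  by (simp add: ell2_ip_def distrib_left suminf_add summable_star_mult)

lemma ell2_ip_diff_right:
  "a \<in> ell2 \<Longrightarrow> b \<in> ell2 \<Longrightarrow> c \<in> ell2 \<Longrightarrow> ell2_ip a (b - c) = ell2_ip a b - ell2_ip a c"
  by (simp add: ell2_ip_def right_diff_distrib suminf_diff summable_star_mult)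

lemma ell2_diff:
  assumes "a \<in> ell2" "b \<in> ell2"
  shows "a - b \<in> ell2"
proof -
  have "summable (\<lambda>n. star (a n) * a n - star (a n) * b n - (star (b n) * a n - star (b n) * b n))"
    by (intro summable_diff summable_star_mult assms)
  then show ?thesis by (simp add: ell2_def star_diff algebra_simps)
qed

lemma apos_ell2_ip: "a \<in> ell2 \<Longrightarrow> apos (ell2_ip a a)"
  unfolding ell2_ip_def by (intro apos_suminf summable_star_mult apos_star_mult_self)

lemma single_in_ell2: "(\<lambda>k. if k = n then a else 0) \<in> ell2"
  unfolding ell2_def mem_Collect_eq by (rule summable_finite[of "{n}"]) auto

lemma ell2_ip_single: "ell2_ip (\<lambda>k. if k = n then a else 0) b = star a * b n"
  unfolding ell2_ip_def
  by (subst suminf_finite[of "{n}"]) auto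

lemma adjointable_ell2: "V \<in> adjointable ip ell2 ell2_ip \<Longrightarrow> V x \<in> ell2"
  by (simp add: adjointable_def)

context hilbert_module
begin

subsection \<open>Analysis operators\<close>

lemma adjoint_op_eqI:
  assumes "\<And>x. ip2 (f x) y = ip x z"
  shows "adjoint_op ip ip2 f y = z"
  unfolding adjoint_op_def
proof (rule the_equality)
  show "\<forall>x. ip2 (f x) y = ip x z" using assms by simp
  show "w = z" if "\<forall>x. ip2 (f x) y = ip x w" for w
    using that assms by (intro ip_eqI) simp
qed

text \<open>A sequence of multipliers either stays in \<open>range act\<close> or has a member
  outside it. Frames and outer frames are these two cases of the same inequalities.\<close>

lemma frame_or_outer_frame_iff:
  "frame_or_outer_frame act ip v \<longleftrightarrow> (\<forall>n. v n \<in> multiplier_module ip) \<and>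
    (\<exists>A>0. \<exists>B>0. \<forall>x. analysis_op ip v x \<in> ell2 \<and>
      A *\<^sub>R ip x x \<preceq> ell2_ip (analysis_op ip v x) (analysis_op ip v x) \<and>
      ell2_ip (analysis_op ip v x) (analysis_op ip v x) \<preceq> B *\<^sub>R ip x x)"
  (is "_ \<longleftrightarrow> _ \<and> ?bounds v")
proof -
  define bounds where "bounds v \<longleftrightarrow> ?bounds v" for v
  have frame: "is_frame ip z \<longleftrightarrow> bounds (\<lambda>n. act (z n))" for z
    by (simp add: bounds_def is_frame_def analysis_op_def ell2_def ell2_ip_def mod_ip_act ip_star)
  have outer: "is_outer_frame act ip v \<longleftrightarrow>
      (\<forall>n. v n \<in> multiplier_module ip) \<and> (\<exists>n. v n \<notin> range act) \<and> bounds v"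
    by (simp add: bounds_def is_outer_frame_def analysis_op_def ell2_def ell2_ip_def)
  have "(\<exists>z. is_frame ip z \<and> v = (\<lambda>n. act (z n))) \<longleftrightarrow> (\<forall>n. v n \<in> range act) \<and> bounds v"
  proof
    assume "\<exists>z. is_frame ip z \<and> v = (\<lambda>n. act (z n))"
    then show "(\<forall>n. v n \<in> range act) \<and> bounds v" by (auto simp: frame)
  next
    assume *: "(\<forall>n. v n \<in> range act) \<and> bounds v"
    then have "\<forall>n. \<exists>z. v n = act z" by auto
    then obtain z where "\<forall>n. v n = act (z n)" by metis
    then have "v = (\<lambda>n. act (z n))" by auto
    with * show "\<exists>z. is_frame ip z \<and> v = (\<lambda>n. act (z n))" by (auto simp: frame)
  qed
  moreover have "v n \<in> multiplier_module ip" if "v n \<in> range act" for n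
    using that act_in_multiplier_module by auto
  ultimately have "frame_or_outer_frame act ip v \<longleftrightarrow> (\<forall>n. v n \<in> multiplier_module ip) \<and> bounds v"
    unfolding frame_or_outer_frame_def outer by blast
  then show ?thesis by (simp only: bounds_def)
qed

text \<open>For a partial sum \<open>p\<close>, \<open>ip p p\<close> is the sum of the
  \<open>star (b n) * W p n\<close>. The weighted Cauchy-Schwarz inequality bounds it by a multiple
  of the sum of the \<open>star (b n) * b n\<close> plus a small multiple of the squared norm of
  \<open>p\<close>, which is absorbed. So the series inherits the Cauchy property from
  \<open>b\<close>.\<close>

lemma synthesis:
  assumes w: "\<And>n. w n \<in> multiplier_module ip"
    and W: "\<And>x. analysis_op ip w x \<in> ell2"
    and bound: "\<And>x. norm (ell2_ip (analysis_op ip w x) (analysis_op ip w x)) \<le> C * (norm x)\<^sup>2"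
    and b: "b \<in> ell2"
  shows "summable (\<lambda>n. w n (b n))" "ip x (\<Sum>n. w n (b n)) = ell2_ip (analysis_op ip w x) b"
proof -
  define W where "W = analysis_op ip w"
  have ip_w: "ip (w n a) x = star a * W x n" for n a x
    unfolding W_def analysis_op_def by (rule ip_multiplier[OF w])
  have ip_w': "ip x (w n a) = star (W x n) * a" for n a x
    using arg_cong[OF ip_w[of n a x], of star] by (simp add: ip_star star_mult star_star)
  \<comment> \<open>The factor 4 makes 2 \<bar>C\<bar> / s at most 1/2, so half of the squared norm
    of \<open>p\<close> survives the absorption. The summand 1 keeps \<open>s\<close> positive if
    \<open>C = 0\<close>.\<close>
  define s where "s = 4 * \<bar>C\<bar> + 1"
  have s: "s > 0" by (simp add: s_def)
  have partial: "(norm (\<Sum>n\<in>F. w n (b n)))\<^sup>2 \<le> 4 * s * norm (\<Sum>n\<in>F. star (b n) * b n)"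
    if "finite F" for F
  proof -
    define p where "p = (\<Sum>n\<in>F. w n (b n))"
    have "norm (\<Sum>n\<in>F. star (W p n) * W p n) \<le> norm (ell2_ip (W p) (W p))"
      unfolding ell2_ip_def
      by (intro norm_apos_mono apos_sum apos_star_mult_self apos_suminf_diff_sum that
          summable_star_mult) (simp_all add: W W_def)
    also have "\<dots> \<le> \<bar>C\<bar> * (norm p)\<^sup>2"
      using bound[of p] mult_right_mono[OF abs_ge_self[of C], of "(norm p)\<^sup>2"] by (simp add: W_def)
    finally have Wp: "norm (\<Sum>n\<in>F. star (W p n) * W p n) \<le> \<bar>C\<bar> * (norm p)\<^sup>2" .
    have "ip p p = (\<Sum>n\<in>F. star (b n) * W p n)"
      by (subst p_def) (simp add: ip.sum_left ip_w)
    then have "(norm p)\<^sup>2 = norm (\<Sum>n\<in>F. star (b n) * W p n)" by (simp flip: norm_ip_self)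
    also have "\<dots> \<le> 2 * (s * norm (\<Sum>n\<in>F. star (b n) * b n) + norm (\<Sum>n\<in>F. star (W p n) * W p n) / s)"
      by (rule norm_sum_star_mult_le[OF s])
    also have "\<dots> \<le> 2 * (s * norm (\<Sum>n\<in>F. star (b n) * b n) + (norm p)\<^sup>2 / 4)"
    proof -
      have "4 * (\<bar>C\<bar> * (norm p)\<^sup>2) \<le> (norm p)\<^sup>2 * s" by (simp add: s_def algebra_simps)
      then have "4 * norm (\<Sum>n\<in>F. star (W p n) * W p n) \<le> (norm p)\<^sup>2 * s" using Wp by linarith
      then show ?thesis using s by (simp add: field_simps)
    qed
    finally show ?thesis by (simp add: p_def)
  qed
  show summable: "summable (\<lambda>n. w n (b n))"
    unfolding summable_Cauchy
  proof (intro allI impI)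
    fix e :: real assume e: "e > 0"
    have "e\<^sup>2 / (4 * s) > 0" using e s by simp
    then obtain N where N: "\<forall>m\<ge>N. \<forall>n. norm (\<Sum>k=m..<n. star (b k) * b k) < e\<^sup>2 / (4 * s)"
      by (rule ell2_Cauchy[OF b])
    have "norm (\<Sum>k=m..<n. w k (b k)) < e" if "m \<ge> N" for m n
    proof -
      have "4 * s * norm (\<Sum>k=m..<n. star (b k) * b k) < e\<^sup>2"
        using N[rule_format, OF that, of n] s by (simp add: field_simps)
      then have "(norm (\<Sum>k=m..<n. w k (b k)))\<^sup>2 < e\<^sup>2"
        using partial[of "{m..<n}"] by simp
      then show ?thesis using e by (simp add: power_less_imp_less_base)
    qed
    then show "\<exists>N. \<forall>m\<ge>N. \<forall>n. norm (\<Sum>k=m..<n. w k (b k)) < e" by blast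
  qed
  have "(\<lambda>n. ip x (w n (b n))) sums ip x (\<Sum>n. w n (b n))"
    by (rule bounded_linear.sums[OF ip.bounded_linear_right summable_sums[OF summable]])
  then show "ip x (\<Sum>n. w n (b n)) = ell2_ip (analysis_op ip w x) b"
    by (simp add: ip_w' ell2_ip_def W_def sums_unique)
qed

lemma adjointable_imp_analysis_op:
  assumes "V \<in> adjointable ip ell2 ell2_ip"
  obtains w where "\<forall>n. w n \<in> multiplier_module ip" "V = analysis_op ip w"
proof -
  obtain g where g: "\<And>x y. y \<in> ell2 \<Longrightarrow> ell2_ip (V x) y = ip x (g y)"
    using assms unfolding adjointable_def by blast
  define w where "w n a = g (\<lambda>k. if k = n then a else 0)" for n a
  have w: "ip (w n a) x = star a * V x n" for n a x
  proof -
    have "ip (w n a) x = star (ell2_ip (V x) (\<lambda>k. if k = n then a else 0))"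
      by (simp add: g[OF single_in_ell2] w_def ip_star)
    also have "\<dots> = star a * V x n"
      by (simp add: star_ell2_ip[OF adjointable_ell2[OF assms] single_in_ell2] ell2_ip_single)
    finally show ?thesis .
  qed
  show thesis
  proof (rule that[of w])
    show "\<forall>n. w n \<in> multiplier_module ip"
    proof
      fix n
      \<comment> \<open>The adjoint of \<open>w n\<close> is the coordinate map
        \<open>\<lambda>x. V x n\<close>.\<close>
      show "w n \<in> multiplier_module ip"
        unfolding multiplier_module_def adjointable_def alg_ip_def
        using w by (auto intro!: exI[of _ "\<lambda>x. V x n"])
    qed
    show "V = analysis_op ip w"
    proof (intro ext)
      show "V x n = analysis_op ip w x n" for x n
        unfolding analysis_op_def by (rule mod_ip_eqI[symmetric]) (rule w)
    qed
  qed
qed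

text \<open>\<open>V\<close> followed by its adjoint is symmetric, hence bounded by
  \<open>bounded_linear_of_symmetric\<close>. Inequalities for \<open>V\<close> thereby become
  inequalities for a bounded selfadjoint operator on the module.\<close>

lemma gram_operator:
  assumes "V \<in> adjointable ip ell2 ell2_ip"
  obtains T where "selfadj T" "\<forall>x y. ip x (blinfun_apply T y) = ell2_ip (V x) (V y)"
proof -
  note V = adjointable_ell2[OF assms]
  obtain g where g: "\<And>x y. y \<in> ell2 \<Longrightarrow> ell2_ip (V x) y = ip x (g y)"
    using assms unfolding adjointable_def by blast
  have ip_gV: "ip x (g (V y)) = ell2_ip (V x) (V y)" for x y by (simp add: g V)
  have sym: "ip (g (V x)) y = ip x (g (V y))" for x y
    by (metis ip_gV ip_star star_ell2_ip V)
  then have "bounded_linear (\<lambda>x. g (V x))" by (rule bounded_linear_of_symmetric)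
  then have T: "blinfun_apply (Blinfun (\<lambda>x. g (V x))) = (\<lambda>x. g (V x))"
    by (rule bounded_linear_Blinfun_apply)
  show thesis
    by (rule that[of "Blinfun (\<lambda>x. g (V x))"]) (simp_all add: selfadj_def T sym ip_gV)
qed

lemma norm_adjointable_le:
  assumes "V \<in> adjointable ip ell2 ell2_ip"
  obtains C where "\<forall>x. norm (ell2_ip (V x) (V x)) \<le> C * (norm x)\<^sup>2"
proof -
  obtain T where T: "selfadj T" "\<forall>x y. ip x (blinfun_apply T y) = ell2_ip (V x) (V y)"
    by (rule gram_operator[OF assms])
  have "norm (ell2_ip (V x) (V x)) \<le> (4 * norm T) * (norm x)\<^sup>2" for x
  proof -
    have "norm (ell2_ip (V x) (V x)) \<le> 4 * (norm x * norm (T x))"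
      using norm_ip_le[of x "T x"] T(2) by simp
    also have "\<dots> \<le> 4 * (norm x * (norm T * norm x))"
      by (intro mult_left_mono norm_blinfun) auto
    finally show ?thesis by (simp add: power2_eq_square mult_ac)
  qed
  then show thesis by (intro that) blast
qed

text \<open>The hypothesis speaks of \<open>apos\<close>, the frame inequalities of
  \<open>cpos\<close>. The passage uses operators: \<open>nonneg_of_apos\<close> makes T - c
  nonnegative, and its root exhibits the difference as an inner square. The upper bound
  \<open>norm T + 1\<close> is positive even if \<open>T = 0\<close>.\<close>

lemma frame_or_outer_frameI:
  assumes V: "V \<in> adjointable ip ell2 ell2_ip" and V_eq: "V = analysis_op ip w"
    and w: "\<forall>n. w n \<in> multiplier_module ip"
    and c: "c > 0" and le: "\<And>x. apos (ell2_ip (V x) (V x) - c *\<^sub>R ip x x)"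
  shows "frame_or_outer_frame act ip w"
proof -
  obtain T where T: "selfadj T" "\<forall>x y. ip x (blinfun_apply T y) = ell2_ip (V x) (V y)"
    by (rule gram_operator[OF V])
  have lower: "c *\<^sub>R ip x x \<preceq> ell2_ip (V x) (V x)" for x
  proof -
    have "nonneg (T - c *\<^sub>R id_blinfun)"
    proof (rule nonneg_of_apos)
      show "selfadj (T - c *\<^sub>R id_blinfun)"
        using T(1) by (simp add: selfadj_diff selfadj_scaleR selfadj_id)
      show "apos (ip x ((T - c *\<^sub>R id_blinfun) x))" for x
        using le[of x] T(2) by (simp add: blinfun.bilinear_simps ip.diff_right ip.scaleR_right)
    qed
    from cpos_ip_of_nonneg[OF this, of x] show ?thesis
      using T(2) by (simp add: cle_def blinfun.bilinear_simps ip.diff_right ip.scaleR_right)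
  qed
  have upper: "ell2_ip (V x) (V x) \<preceq> (norm T + 1) *\<^sub>R ip x x" for x
  proof -
    have "nonneg ((norm T + 1) *\<^sub>R id_blinfun - T)"
      by (rule nonneg_diff_of_norm_le[OF T(1)]) simp
    from cpos_ip_of_nonneg[OF this, of x] show ?thesis
      using T(2) by (simp add: cle_def blinfun.bilinear_simps ip.diff_right ip.scaleR_right)
  qed
  have "norm T + 1 > 0" using norm_ge_zero[of T] by linarith
  then show ?thesis
    unfolding frame_or_outer_frame_iff V_eq[symmetric] using w c lower upper adjointable_ell2[OF V] by blast
qed

text \<open>For K = 1 - f / (t + c) the bound in \<open>nonneg\<close> gives norm K \<le> t / (t +
  c) < 1, so f x = y is the fixed point equation of a contraction.\<close>

lemma bij_of_nonneg_diff:
  assumes c: "c > 0" and le: "nonneg (f - c *\<^sub>R id_blinfun)"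
  shows "bij (blinfun_apply f)"
proof -
  obtain t where t: "t > 0" "norm (t *\<^sub>R id_blinfun - (f - c *\<^sub>R id_blinfun)) \<le> t"
    using nonneg_positive_bound[OF le] .
  define K where "K = id_blinfun - (1 / (t + c)) *\<^sub>R f"
  have "K = (1 / (t + c)) *\<^sub>R (t *\<^sub>R id_blinfun - (f - c *\<^sub>R id_blinfun))"
    using c t(1) by (simp add: K_def scaleR_diff_right algebra_simps flip: scaleR_add_left)
  then have "norm K \<le> t / (t + c)"
    using c t by (simp add: divide_right_mono)
  also have "\<dots> < 1" using c t(1) by simp
  finally have K: "norm K < 1" .
  have fK: "f x = (t + c) *\<^sub>R (x - K x)" for x
    using c t(1) by (simp add: K_def blinfun.bilinear_simps)
  have "\<exists>!x. f x = y" for y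
  proof -
    have "\<exists>!x. K x + (1 / (t + c)) *\<^sub>R y = x"
    proof (rule banach_fix_type[where c="norm K"])
      show "\<forall>x z. dist (K x + (1 / (t + c)) *\<^sub>R y) (K z + (1 / (t + c)) *\<^sub>R y) \<le> norm K * dist x z"
        by (simp add: dist_norm norm_blinfun flip: blinfun.diff_right)
    qed (use K in auto)
    moreover have "K x + (1 / (t + c)) *\<^sub>R y = x \<longleftrightarrow> f x = y" for x
    proof -
      have "y = (t + c) *\<^sub>R ((1 / (t + c)) *\<^sub>R y)" using c t(1) by simp
      then have "f x = y \<longleftrightarrow> x - K x = (1 / (t + c)) *\<^sub>R y"
        unfolding fK using c t(1) by (metis add_pos_pos less_irrefl scaleR_cancel_left)
      then show ?thesis by (auto simp: algebra_simps)
    qed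
    ultimately show ?thesis by simp
  qed
  then show ?thesis by (simp add: bij_iff)
qed

end

section \<open>Analysis operators of the duals of a frame or outer frame\<close>

theorem theorem4p6:
  fixes act :: "'x::complex_banach \<Rightarrow> 'a::cstar_algebra \<Rightarrow> 'x"
    and ip :: "'x \<Rightarrow> 'x \<Rightarrow> 'a"
    and xs :: "nat \<Rightarrow> 'a \<Rightarrow> 'x"
    and U V :: "'x \<Rightarrow> nat \<Rightarrow> 'a"
    and Uadj :: "(nat \<Rightarrow> 'a) \<Rightarrow> 'x"
  assumes "hilbert_module act ip"
    and "frame_or_outer_frame act ip xs"
    and "U = analysis_op ip xs"
    and "Uadj = adjoint_op ip ell2_ip U"
    and "V \<in> adjointable ip ell2 ell2_ip"
  shows "(\<exists>ys. frame_or_outer_frame act ip ys \<and> is_dual_to ip ys xs \<and> V = analysis_op ip ys)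
    \<longleftrightarrow>
    (\<exists>L \<in> adjointable ip ell2 ell2_ip.
      V = (U \<circ> inv (Uadj \<circ> U)) + ((id - (U \<circ> inv (Uadj \<circ> U) \<circ> Uadj)) \<circ> L))"
proof -
  interpret hilbert_module act ip by fact
  note V = adjointable_ell2[OF assms(5)]
  obtain A B where A: "A > 0" and B: "B > 0" and bounds: "\<forall>x. U x \<in> ell2 \<and>
      A *\<^sub>R ip x x \<preceq> ell2_ip (U x) (U x) \<and> ell2_ip (U x) (U x) \<preceq> B *\<^sub>R ip x x"
    using assms(2)[unfolded frame_or_outer_frame_iff, folded assms(3)] by blast
  have xs: "xs n \<in> multiplier_module ip" for n
    using assms(2) by (simp add: frame_or_outer_frame_iff)
  have U: "U x \<in> ell2" "A *\<^sub>R ip x x \<preceq> ell2_ip (U x) (U x)" "ell2_ip (U x) (U x) \<preceq> B *\<^sub>R ip x x" for x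
    using bounds by simp_all
  have U_bound: "norm (ell2_ip (U x) (U x)) \<le> B * (norm x)\<^sup>2" for x
  proof -
    have "norm (ell2_ip (U x) (U x)) \<le> norm (B *\<^sub>R ip x x)"
      using U(3)[of x] by (intro norm_apos_mono apos_ell2_ip U) (simp add: cle_def cpos_imp_apos)
    then show ?thesis using B by (simp add: norm_ip_self)
  qed
  \<comment> \<open>\<open>adjoint_op\<close> is a definite description; synthesis along
    \<open>xs\<close> provides the vector that it denotes at each \<open>y\<close> in
    \<open>ell2\<close>.\<close>
  have Uadj: "ip x (Uadj y) = ell2_ip (U x) y" if "y \<in> ell2" for x y
  proof -
    have *: "ell2_ip (U z) y = ip z (\<Sum>n. xs n (y n))" for z
      using synthesis(2)[OF xs _ _ that, where C = B and x = z] U(1) U_bound by (simp add: assms(3))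
    have "Uadj y = (\<Sum>n. xs n (y n))" unfolding assms(4) by (rule adjoint_op_eqI) (rule *)
    then show ?thesis using * by simp
  qed
  have U_adjointable: "U \<in> adjointable ip ell2 ell2_ip"
    by (auto simp: adjointable_def U(1) Uadj intro!: exI[of _ Uadj])
  \<comment> \<open>By \<open>synthesis\<close>, the dual expansion of \<open>x\<close> sums to the
    adjoint of \<open>V\<close> applied to \<open>U x\<close>. Tested against inner products,
    duality says that this is \<open>x\<close>; taking \<open>star\<close> moves the adjoint from
    \<open>V\<close> to \<open>U\<close>.\<close>
  have dual_iff: "is_dual_to ip ys xs \<longleftrightarrow> (\<forall>x. Uadj (V x) = x)"
    if ys: "\<forall>n. ys n \<in> multiplier_module ip" "V = analysis_op ip ys" for ys
  proof -
    obtain C where C: "\<forall>x. norm (ell2_ip (V x) (V x)) \<le> C * (norm x)\<^sup>2"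
      by (rule norm_adjointable_le[OF assms(5)])
    define p where "p x = (\<Sum>n. ys n (U x n))" for x
    have p: "summable (\<lambda>n. ys n (U x n))" "ip z (p x) = ell2_ip (V z) (U x)" for x z
      using synthesis(1)[where w = ys and C = C and b = "U x"]
        synthesis(2)[where w = ys and C = C and b = "U x" and x = z] ys C V U(1) by (simp_all add: p_def)
    have "is_dual_to ip ys xs \<longleftrightarrow> (\<forall>x. p x = x)"
      unfolding is_dual_to_def using p(1) by (simp add: sums_iff p_def assms(3) analysis_op_def)
    also have "\<dots> \<longleftrightarrow> (\<forall>x z. ell2_ip (V z) (U x) = ip z x)"
      unfolding ip_eq_iff[of "p _"] p(2) ..
    also have "\<dots> \<longleftrightarrow> (\<forall>x z. ell2_ip (U x) (V z) = ip x z)"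
    proof -
      have "ell2_ip (V z) (U x) = ip z x \<longleftrightarrow> ell2_ip (U x) (V z) = ip x z" for x z
      proof -
        have "star (ell2_ip (V z) (U x)) = ell2_ip (U x) (V z)" "star (ip z x) = ip x z"
          by (simp_all add: star_ell2_ip V U(1) ip_star)
        then show ?thesis by (metis star_star)
      qed
      then show ?thesis by simp
    qed
    also have "\<dots> \<longleftrightarrow> (\<forall>z. Uadj (V z) = z)"
      unfolding ip_eq_iff[of "Uadj _"] Uadj[OF V] by blast
    finally show ?thesis .
  qed
  have bij: "bij (Uadj \<circ> U)"
  proof -
    obtain S where S: "selfadj S" "\<forall>x y. ip x (blinfun_apply S y) = ell2_ip (U x) (U y)"
      by (rule gram_operator[OF U_adjointable])
    \<comment> \<open>The lower frame bound \<open>A\<close> is what makes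
      \<open>Uadj \<circ> U\<close> invertible.\<close>
    have "nonneg (S - A *\<^sub>R id_blinfun)"
    proof (rule nonneg_of_apos)
      show "selfadj (S - A *\<^sub>R id_blinfun)"
        using S(1) by (simp add: selfadj_diff selfadj_scaleR selfadj_id)
      show "apos (ip x ((S - A *\<^sub>R id_blinfun) x))" for x
        using cpos_imp_apos U(2)[of x] S(2)
        by (simp add: cle_def blinfun.bilinear_simps ip.diff_right ip.scaleR_right)
    qed
    then have "bij (blinfun_apply S)" by (rule bij_of_nonneg_diff[OF A])
    also have "blinfun_apply S = Uadj \<circ> U"
      by (intro ext ip_eqI) (simp add: S(2) Uadj[OF U(1)])
    finally show ?thesis .
  qed
  then have SU: "Uadj (U (inv (Uadj \<circ> U) x)) = x" for x
    using surj_f_inv_f[OF bij_is_surj, of "Uadj \<circ> U" x] by simp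
  let ?R = "inv (Uadj \<circ> U)"
  show ?thesis
  proof
    assume "\<exists>ys. frame_or_outer_frame act ip ys \<and> is_dual_to ip ys xs \<and> V = analysis_op ip ys"
    then obtain ys where ys: "frame_or_outer_frame act ip ys" "is_dual_to ip ys xs" "V = analysis_op ip ys"
      by blast
    have "\<forall>n. ys n \<in> multiplier_module ip" using ys(1) by (simp add: frame_or_outer_frame_iff)
    then have "Uadj (V x) = x" for x using dual_iff[OF _ ys(3)] ys(2) by simp
    \<comment> \<open>For \<open>L = V\<close>, the subtracted term reduces to
      \<open>U \<circ> ?R\<close> and cancels the first summand.\<close>
    then have "V = (U \<circ> ?R) + ((id - (U \<circ> ?R \<circ> Uadj)) \<circ> V)"
      by (intro ext) simp
    then show "\<exists>L \<in> adjointable ip ell2 ell2_ip. V = (U \<circ> ?R) + ((id - (U \<circ> ?R \<circ> Uadj)) \<circ> L)"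
      using assms(5) by blast
  next
    assume "\<exists>L \<in> adjointable ip ell2 ell2_ip. V = (U \<circ> ?R) + ((id - (U \<circ> ?R \<circ> Uadj)) \<circ> L)"
    then obtain L where "L \<in> adjointable ip ell2 ell2_ip"
      and V_eq: "V = (U \<circ> ?R) + ((id - (U \<circ> ?R \<circ> Uadj)) \<circ> L)"
      by blast
    then have L: "L x \<in> ell2" for x by (simp add: adjointable_ell2)
    \<comment> \<open>This is \<open>Uadj (V x) = x\<close> in weak form: as \<open>?R\<close> is a
      right inverse of \<open>Uadj \<circ> U\<close>, the two terms involving \<open>L\<close>
      cancel.\<close>
    have UV: "ell2_ip (U z) (V x) = ip z x" for z x
    proof -
      have "V x = U (?R x) + (L x - U (?R (Uadj (L x))))" by (simp add: V_eq)
      then have "ell2_ip (U z) (V x) = ip z (Uadj (U (?R x))) + (ip z (Uadj (L x)) - ip z (Uadj (U (?R (Uadj (L x))))))"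
        by (simp add: ell2_ip_add_right ell2_ip_diff_right ell2_diff U(1) L Uadj)
      then show ?thesis by (simp add: SU)
    qed
    obtain ys where ys: "\<forall>n. ys n \<in> multiplier_module ip" "V = analysis_op ip ys"
      by (rule adjointable_imp_analysis_op[OF assms(5)])
    have "is_dual_to ip ys xs"
      unfolding dual_iff[OF ys] ip_eq_iff[of "Uadj _"] Uadj[OF V] UV by simp
    moreover have "frame_or_outer_frame act ip ys"
    proof (rule frame_or_outer_frameI[OF assms(5) ys(2,1), where c = "1 / B"])
      show "apos (ell2_ip (V x) (V x) - (1 / B) *\<^sub>R ip x x)" for x
      proof -
        \<comment> \<open>expand \<open>0 \<le> \<langle>V x - U x / B, V x - U x / B\<rangle>\<close>\<close>
        have VU: "ell2_ip (V x) (U x) = ip x x"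
          using star_ell2_ip[OF U(1) V, of x x] by (simp add: UV ip_star)
        define D where "D = ell2_ip (V x) (V x) - (2 / B) *\<^sub>R ip x x + (1 / B\<^sup>2) *\<^sub>R ell2_ip (U x) (U x)"
        have two: "(2 / B) *\<^sub>R ip x x = (1 / B) *\<^sub>R ip x x + (1 / B) *\<^sub>R ip x x"
          by (simp flip: scaleR_add_left)
        let ?f = "\<lambda>n. V x n - (1 / B) *\<^sub>R U x n"
        have "(\<lambda>n. (star (V x n) * V x n - (1 / B) *\<^sub>R (star (V x n) * U x n))
            - (1 / B) *\<^sub>R (star (U x n) * V x n - (1 / B) *\<^sub>R (star (U x n) * U x n)))
          sums ((ell2_ip (V x) (V x) - (1 / B) *\<^sub>R ip x x) - (1 / B) *\<^sub>R (ip x x - (1 / B) *\<^sub>R ell2_ip (U x) (U x)))"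
          using ell2_ip_sums[OF V V] ell2_ip_sums[OF V U(1), of x x] ell2_ip_sums[OF U(1) V, of x x]
            ell2_ip_sums[OF U(1) U(1)] unfolding VU UV
          by (intro sums_diff sums_scaleR_right)
        also have "(\<lambda>n. (star (V x n) * V x n - (1 / B) *\<^sub>R (star (V x n) * U x n))
            - (1 / B) *\<^sub>R (star (U x n) * V x n - (1 / B) *\<^sub>R (star (U x n) * U x n)))
          = (\<lambda>n. star (?f n) * ?f n)"
          by (simp add: star_diff star_scaleR algebra_simps)
        also have "(ell2_ip (V x) (V x) - (1 / B) *\<^sub>R ip x x) - (1 / B) *\<^sub>R (ip x x - (1 / B) *\<^sub>R ell2_ip (U x) (U x)) = D"
          by (simp add: D_def two power2_eq_square scaleR_diff_right)
        finally have "apos D"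
          using apos_suminf[of "\<lambda>n. star (?f n) * ?f n"] by (simp add: sums_iff apos_star_mult_self)
        \<comment> \<open>The upper frame bound, divided by B^2, trades the \<open>U\<close> term of
          \<open>D\<close> for \<open>(1 / B) *\<^sub>R ip x x\<close>, which turns the coefficient
          -2/B into -1/B.\<close>
        moreover have "apos ((1 / B\<^sup>2) *\<^sub>R (B *\<^sub>R ip x x - ell2_ip (U x) (U x)))"
          using U(3)[of x] by (simp add: apos_scaleR cpos_imp_apos cle_def)
        ultimately have "apos (D + (1 / B\<^sup>2) *\<^sub>R (B *\<^sub>R ip x x - ell2_ip (U x) (U x)))"
          by (rule apos_add)
        also have "D + (1 / B\<^sup>2) *\<^sub>R (B *\<^sub>R ip x x - ell2_ip (U x) (U x))
          = ell2_ip (V x) (V x) - (1 / B) *\<^sub>R ip x x"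
          using B by (simp add: D_def two scaleR_diff_right power2_eq_square)
        finally show "apos (ell2_ip (V x) (V x) - (1 / B) *\<^sub>R ip x x)" .
      qed
    qed (use B in simp)
    ultimately show "\<exists>ys. frame_or_outer_frame act ip ys \<and> is_dual_to ip ys xs \<and> V = analysis_op ip ys"
      using ys(2) by blast
  qed
qed

end
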